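(* Let $(\mathfrak{g},\mu)$ be a finite-dimensional real Lie algebra. If $H^2(\mathfrak{g},\mathfrak{g})=0$, then there exist an open neighborhood $U\subset\wedge^2\mathfrak{g}^*\otimes\mathfrak{g}$ of $\mu$ and a smooth map $h:U\to\mathrm{GL}(\mathfrak{g})$ such that $h(\mu')\cdot\mu=\mu'$ for every Lie bracket $\mu'\in U$. In particular, $(\mathfrak{g},\mu)$ is rigid.
   Context: Here $\mu:\wedge^2\mathfrak{g}\to\mathfrak{g}$ is the Lie bracket, and $\mathrm{GL}(\mathfrak{g})$ acts on $\wedge^2\mathfrak{g}^*\otimes\mathfrak{g}=\mathrm{Hom}(\wedge^2\mathfrak{g},\mathfrak{g})$ by $(A\cdot\mu)(u,v)=A\mu(A^{-1}u,A^{-1}v)$. $H^2(\mathfrak{g},\mathfrak{g})$ is the second Chevalley–Eilenberg cohomology of $(\mathfrak{g},\mu)$ with coefficients in the adjoint representation. The Lie algebra $(\mathfrak{g},\mu)$ is called rigid if every Lie bracket $\mu'$ on the vector space $\mathfrak{g}$ sufficiently close to $\mu$ is of the form $\mu'=A\cdot\mu$ for some $A\in\mathrm{GL}(\mathfrak{g})$ close to the identity (i.e. for every neighborhood $V$ of the identity in $\mathrm{GL}(\mathfrak{g})$ there is a neighborhood of $\mu$ such that every Lie bracket $\mu'$ in it equals $A\cdot\mu$ for some $A\in V$). *)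

theory Defs
  imports "HOL-Analysis.Analysis"
begin

section \<open>The space of alternating bilinear maps\<close>

text \<open>
  The type \<open>'a alt_bilin\<close> is Hom(\<open>\<Lambda>\<^sup>2 'a\<close>, \<open>'a\<close>), i.e. \<open>\<Lambda>\<^sup>2 'a* \<otimes> 'a\<close>, with the operator norm.
  Only bounded maps are included, which is no restriction when \<open>'a\<close> is finite-dimensional.
  There all norms are equivalent, so the norm on \<open>'a\<close> serves only to provide the canonical
  topology and smooth structure of the finite-dimensional spaces involved.
\<close>

typedef (overloaded) ('a::real_normed_vector) alt_bilin =
  "{f :: 'a \<Rightarrow>\<^sub>L 'a \<Rightarrow>\<^sub>L 'a. \<forall>x. blinfun_apply (blinfun_apply f x) x = 0}"
  morphisms blinfun_of_alt Alt_bilin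
  by (rule exI[of _ 0]) simp

setup_lifting type_definition_alt_bilin

instantiation alt_bilin :: (real_normed_vector) real_normed_vector
begin

lift_definition zero_alt_bilin :: "'a alt_bilin" is 0 by simp

lift_definition plus_alt_bilin :: "'a alt_bilin \<Rightarrow> 'a alt_bilin \<Rightarrow> 'a alt_bilin" is "(+)"
  by (simp add: blinfun.add_left)

lift_definition minus_alt_bilin :: "'a alt_bilin \<Rightarrow> 'a alt_bilin \<Rightarrow> 'a alt_bilin" is "(-)"
  by (simp add: blinfun.diff_left)

lift_definition uminus_alt_bilin :: "'a alt_bilin \<Rightarrow> 'a alt_bilin" is uminus
  by (simp add: blinfun.minus_left)

lift_definition scaleR_alt_bilin :: "real \<Rightarrow> 'a alt_bilin \<Rightarrow> 'a alt_bilin" is scaleR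
  by (simp add: blinfun.scaleR_left)

lift_definition norm_alt_bilin :: "'a alt_bilin \<Rightarrow> real" is norm .

definition dist_alt_bilin :: "'a alt_bilin \<Rightarrow> 'a alt_bilin \<Rightarrow> real"
  where "dist_alt_bilin a b = norm (a - b)"

definition sgn_alt_bilin :: "'a alt_bilin \<Rightarrow> 'a alt_bilin"
  where "sgn_alt_bilin x = inverse (norm x) *\<^sub>R x"

definition [code del]:
  "(uniformity :: ('a alt_bilin \<times> 'a alt_bilin) filter) =
    (INF e\<in>{0 <..}. principal {(x, y). dist x y < e})"

definition open_alt_bilin :: "'a alt_bilin set \<Rightarrow> bool"
  where [code del]:
    "open_alt_bilin S = (\<forall>x\<in>S. \<forall>\<^sub>F (x', y) in uniformity. x' = x \<longrightarrow> y \<in> S)"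

instance
  apply standard
  unfolding dist_alt_bilin_def open_alt_bilin_def sgn_alt_bilin_def uniformity_alt_bilin_def
  apply (rule refl | (transfer, force simp: algebra_simps norm_triangle_ineq))+
  done

end

definition alt_apply :: "'a::real_normed_vector alt_bilin \<Rightarrow> 'a \<Rightarrow> 'a \<Rightarrow> 'a" where
  "alt_apply \<mu> x y = blinfun_apply (blinfun_apply (blinfun_of_alt \<mu>) x) y"


section \<open>Lie brackets, the action of GL, and rigidity\<close>

definition is_lie_bracket :: "'a::real_normed_vector alt_bilin \<Rightarrow> bool" where
  "is_lie_bracket \<mu> \<longleftrightarrow>
    (\<forall>x y z. alt_apply \<mu> x (alt_apply \<mu> y z)
           + alt_apply \<mu> y (alt_apply \<mu> z x)
           + alt_apply \<mu> z (alt_apply \<mu> x y) = 0)"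

text \<open>
  In finite dimension the inverse of a bijective linear map is automatically bounded, and
  this set is open in \<open>'a \<Rightarrow>\<^sub>L 'a\<close>.
\<close>

definition GL :: "('a::real_normed_vector \<Rightarrow>\<^sub>L 'a) set" where
  "GL = {A. bij (blinfun_apply A)}"

definition gl_act ::
    "('a::real_normed_vector \<Rightarrow>\<^sub>L 'a) \<Rightarrow> 'a alt_bilin \<Rightarrow> 'a \<Rightarrow> 'a \<Rightarrow> 'a" where
  "gl_act A \<mu> = (\<lambda>u v.
    blinfun_apply A (alt_apply \<mu> (inv (blinfun_apply A) u) (inv (blinfun_apply A) v)))"

definition lie_rigid :: "'a::real_normed_vector alt_bilin \<Rightarrow> bool" where
  "lie_rigid \<mu> \<longleftrightarrow>
    (\<forall>V :: ('a \<Rightarrow>\<^sub>L 'a) set. open V \<and> id_blinfun \<in> V \<longrightarrow>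
      (\<exists>N. open N \<and> \<mu> \<in> N \<and>
        (\<forall>\<mu>'\<in>N. is_lie_bracket \<mu>' \<longrightarrow>
          (\<exists>A \<in> V \<inter> GL. alt_apply \<mu>' = gl_act A \<mu>))))"


section \<open>Second Chevalley--Eilenberg cohomology with adjoint coefficients\<close>

text \<open>
  The coboundaries of a 1-cochain and of a 2-cochain. For finite-dimensional \<open>'a\<close>, the
  cochain spaces in degrees 1 and 2 are \<open>'a \<Rightarrow>\<^sub>L 'a\<close> and \<open>'a alt_bilin\<close>.
\<close>

definition ce_d1 ::
    "'a::real_normed_vector alt_bilin \<Rightarrow> ('a \<Rightarrow>\<^sub>L 'a) \<Rightarrow> 'a \<Rightarrow> 'a \<Rightarrow> 'a" where
  "ce_d1 \<mu> f x y =
      alt_apply \<mu> x (blinfun_apply f y) - alt_apply \<mu> y (blinfun_apply f x)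
    - blinfun_apply f (alt_apply \<mu> x y)"

definition ce_d2 ::
    "'a::real_normed_vector alt_bilin \<Rightarrow> 'a alt_bilin \<Rightarrow> 'a \<Rightarrow> 'a \<Rightarrow> 'a \<Rightarrow> 'a" where
  "ce_d2 \<mu> \<phi> x y z =
      alt_apply \<mu> x (alt_apply \<phi> y z) - alt_apply \<mu> y (alt_apply \<phi> x z)
    + alt_apply \<mu> z (alt_apply \<phi> x y)
    - alt_apply \<phi> (alt_apply \<mu> x y) z + alt_apply \<phi> (alt_apply \<mu> x z) y
    - alt_apply \<phi> (alt_apply \<mu> y z) x"

definition ce_Z2 :: "'a::real_normed_vector alt_bilin \<Rightarrow> 'a alt_bilin set" where
  "ce_Z2 \<mu> = {\<phi>. \<forall>x y z. ce_d2 \<mu> \<phi> x y z = 0}"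

definition ce_B2 :: "'a::real_normed_vector alt_bilin \<Rightarrow> 'a alt_bilin set" where
  "ce_B2 \<mu> = {\<phi>. \<exists>f. alt_apply \<phi> = ce_d1 \<mu> f}"

text \<open>The quotient \<open>Z\<^sup>2 / B\<^sup>2\<close>, as a set of cosets; its zero element is the coset \<open>B\<^sup>2\<close>.\<close>

definition ce_H2 :: "'a::real_normed_vector alt_bilin \<Rightarrow> 'a alt_bilin set set" where
  "ce_H2 \<mu> = ce_Z2 \<mu> // {(\<phi>, \<psi>). \<phi> \<in> ce_Z2 \<mu> \<and> \<psi> \<in> ce_Z2 \<mu> \<and> \<phi> - \<psi> \<in> ce_B2 \<mu>}"


section \<open>Smooth maps\<close>

text \<open>
  On an open subset of a finite-dimensional space, a map is \<open>C\<^sup>k\<^sup>+\<^sup>1\<close> iff it is differentiable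
  and all its directional derivatives \<open>x \<mapsto> Df(x)v\<close> are \<open>C\<^sup>k\<close>. Both notions below are
  meant for open \<open>S\<close> in finite dimension only.
\<close>

primrec Ck_on ::
    "nat \<Rightarrow> 'a::real_normed_vector set \<Rightarrow> ('a \<Rightarrow> 'b::real_normed_vector) \<Rightarrow> bool" where
  "Ck_on 0 S f \<longleftrightarrow> continuous_on S f"
| "Ck_on (Suc k) S f \<longleftrightarrow>
    (\<forall>x\<in>S. f differentiable at x) \<and>
    (\<forall>v. Ck_on k S (\<lambda>x. frechet_derivative f (at x) v))"

definition smooth_on ::
    "'a::real_normed_vector set \<Rightarrow> ('a \<Rightarrow> 'b::real_normed_vector) \<Rightarrow> bool" where
  "smooth_on S f \<longleftrightarrow> (\<forall>k. Ck_on k S f)"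

end

theory Submission
  imports Defs
begin

text \<open>
  Choose a right inverse \<open>g\<close> of the coboundary \<open>d\<close> on the coboundaries. By the implicit function
  theorem every \<open>\<mu>'\<close> near \<open>\<mu>\<close> is \<open>(1 + X) \<cdot> (\<mu> + w)\<close>, where \<open>X\<close> and \<open>w\<close> depend smoothly on
  \<open>\<mu>'\<close> and \<open>w\<close> lies in the complement \<open>{\<phi> - d (g \<phi>)}\<close> of the coboundaries. If \<open>\<mu>'\<close> is a Lie
  bracket then so is \<open>\<mu> + w\<close>, hence the second coboundary of \<open>w\<close> is quadratic in \<open>w\<close>; since
  \<open>H\<^sup>2 = 0\<close> makes that coboundary injective on the complement, this forces \<open>w = 0\<close> for small \<open>w\<close>.
  The implicit function theorem is proved from the contraction principle, because the type of \<open>\<mu>\<close>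
  is not a Euclidean space type even when it is finite-dimensional.
\<close>

section \<open>Finite-dimensional normed spaces\<close>

text \<open>That the brackets near \<mu> form a manifold is known only once the theorem is proved,
  so the implicit function theorem is not applied to the Jacobi identity. It is applied to all
  alternating maps near \<mu>. The Jacobi identity enters afterwards, one bracket at a time, and
  only to force w = 0. Hence the smooth map lives on a full neighbourhood of \<mu>, while its
  relation to the action is claimed at brackets alone. The expression (1 + X) . (\<mu> + w) has
  derivative \<open>w - d X\<close> at X = 0, w = 0. With \<open>X = - g \<phi>\<close> and
  \<open>w = \<phi> - d (g \<phi>)\<close> this derivative is \<phi> itself. The equation for a
  displacement n of \<mu> therefore reads \<phi> = n + terms of higher order, which is already in
  contraction form. Finite dimension is a predicate on types because it has to pass from
  \<open>'a\<close> to products, to \<open>'a \<Rightarrow>\<^sub>L 'a\<close> and to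
  \<open>'a alt_bilin\<close>.\<close>

definition findim :: "'a::real_normed_vector itself \<Rightarrow> bool" where
  "findim _ \<longleftrightarrow> (\<exists>B::'a set. finite B \<and> span B = UNIV)"

text \<open>The bound carries the Cauchy property from vectors to their coefficients, and the reals
  are complete. It serves the induction step of \<open>independent_coefficients_bounded\<close>,
  where a vector outside a closed span has positive distance from it.\<close>

lemma closed_span_if_coefficients_bounded:
  fixes B :: "'a::real_normed_vector set"
  assumes "finite B" and "C > 0"
    and C: "\<And>u. (\<Sum>b\<in>B. \<bar>u b\<bar>) \<le> C * norm (\<Sum>b\<in>B. u b *\<^sub>R b)"
  shows "closed (span B)"
  unfolding closed_sequential_limits
proof (intro allI impI, elim conjE)
  fix x l assume xB: "\<forall>n. x n \<in> span B" and lim: "x \<longlonglongrightarrow> l"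
  from xB have "\<forall>n. \<exists>u. x n = (\<Sum>b\<in>B. u b *\<^sub>R b)"
    unfolding span_finite[OF assms(1)] by blast
  then obtain u where u: "\<And>n. x n = (\<Sum>b\<in>B. u n b *\<^sub>R b)" by metis
  have bound: "\<bar>u m b - u n b\<bar> \<le> C * norm (x m - x n)" if "b \<in> B" for m n b
  proof -
    have "\<bar>u m b - u n b\<bar> \<le> (\<Sum>b\<in>B. \<bar>u m b - u n b\<bar>)"
      using that assms(1) by (intro member_le_sum) auto
    also have "\<dots> \<le> C * norm (x m - x n)"
      using C[of "\<lambda>b. u m b - u n b"] by (simp add: u scaleR_left_diff_distrib sum_subtractf)
    finally show ?thesis .
  qed
  have "Cauchy x" using lim by (rule LIMSEQ_imp_Cauchy)
  have "convergent (\<lambda>n. u n b)" if "b \<in> B" for b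
  proof -
    have "Cauchy (\<lambda>n. u n b)"
    proof (rule metric_CauchyI)
      fix e :: real assume "e > 0"
      then have "e / C > 0" using \<open>C > 0\<close> by simp
      then obtain M where M: "\<And>m n. m \<ge> M \<Longrightarrow> n \<ge> M \<Longrightarrow> dist (x m) (x n) < e / C"
        using \<open>Cauchy x\<close> unfolding Cauchy_def by blast
      have "dist (u m b) (u n b) < e" if "m \<ge> M" "n \<ge> M" for m n
        using bound[OF \<open>b \<in> B\<close>, of m n] M[OF that] \<open>C > 0\<close>
        by (simp add: dist_norm pos_less_divide_eq mult.commute)
      then show "\<exists>M. \<forall>m\<ge>M. \<forall>n\<ge>M. dist (u m b) (u n b) < e" by blast
    qed
    then show ?thesis by (simp add: Cauchy_convergent_iff)
  qed
  then have "\<exists>v. \<forall>b\<in>B. (\<lambda>n. u n b) \<longlonglongrightarrow> v b"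
    unfolding convergent_def by (intro bchoice) blast
  then obtain v where v: "\<And>b. b \<in> B \<Longrightarrow> (\<lambda>n. u n b) \<longlonglongrightarrow> v b" by blast
  have "x \<longlonglongrightarrow> (\<Sum>b\<in>B. v b *\<^sub>R b)"
    unfolding u by (intro tendsto_intros v)
  then have "l = (\<Sum>b\<in>B. v b *\<^sub>R b)" using LIMSEQ_unique[OF lim] by blast
  then show "l \<in> span B"
    by (simp add: span_sum span_scale span_base)
qed

text \<open>This is the equivalence of norms in finite dimension, obtained by adding one basis
  vector at a time instead of by compactness of a sphere. The distance d of the new vector from the
  old span controls its coefficient, and the induction hypothesis controls the others.\<close>

lemma independent_coefficients_bounded:
  fixes B :: "'a::real_normed_vector set"
  assumes "finite B" and "independent B"
  shows "\<exists>C>0. \<forall>u. (\<Sum>b\<in>B. \<bar>u b\<bar>) \<le> C * norm (\<Sum>b\<in>B. u b *\<^sub>R b)"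
  using assms
proof (induction B rule: finite_induct)
  case empty
  then show ?case by (auto intro: exI[of _ 1])
next
  case (insert a B)
  then have "independent B" and a: "a \<notin> span B" by (auto simp: independent_insert)
  with insert.IH obtain C where C0: "C > 0"
    and C: "\<And>u. (\<Sum>b\<in>B. \<bar>u b\<bar>) \<le> C * norm (\<Sum>b\<in>B. u b *\<^sub>R b)" by auto
  have "closed (span B)"
    using closed_span_if_coefficients_bounded[OF insert.hyps(1) C0 C] .
  then obtain d where d0: "d > 0" and "ball a d \<subseteq> - span B"
    using a by (metis ComplI open_Compl openE)
  then have d: "d \<le> norm (a - y)" if "y \<in> span B" for y
    using that by (force simp: dist_norm subset_iff not_less)
  \<comment> \<open>For \<open>x = u a *\<^sub>R a + s\<close> the new coefficient is at most
    \<open>norm x / d\<close>, and hence \<open>norm s\<close> is at most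
    \<open>(1 + norm a / d) * norm x\<close>. The old coefficients cost another factor C.\<close>
  let ?K = "1 / d + C * (1 + norm a / d)"
  have "(\<Sum>b\<in>insert a B. \<bar>u b\<bar>) \<le> ?K * norm (\<Sum>b\<in>insert a B. u b *\<^sub>R b)" for u
  proof -
    define s where "s = (\<Sum>b\<in>B. u b *\<^sub>R b)"
    define x where "x = u a *\<^sub>R a + s"
    have s: "s \<in> span B" unfolding s_def by (intro span_sum span_scale span_base)
    have ua: "\<bar>u a\<bar> * d \<le> norm x"
    proof (cases "u a = 0")
      case False
      \<comment> \<open>Dividing x by its coefficient at a leaves a minus an element of the
        span.\<close>
      have "d \<le> norm (a - (- (1 / u a)) *\<^sub>R s)"
        by (intro d span_scale s)
      then have "\<bar>u a\<bar> * d \<le> norm (u a *\<^sub>R (a - (- (1 / u a)) *\<^sub>R s))"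
        by (simp add: mult_left_mono)
      then show ?thesis using False by (simp add: x_def scaleR_right_distrib)
    qed simp
    then have ua': "\<bar>u a\<bar> \<le> norm x / d" using d0 by (simp add: pos_le_divide_eq)
    have "norm s \<le> norm x + \<bar>u a\<bar> * norm a"
      using norm_triangle_ineq4[of x "u a *\<^sub>R a"] by (simp add: x_def)
    also have "\<dots> \<le> norm x + norm x / d * norm a"
      by (intro add_left_mono mult_right_mono ua') simp
    finally have "C * norm s \<le> C * ((1 + norm a / d) * norm x)"
      using C0 by (intro mult_left_mono) (simp_all add: algebra_simps)
    with ua' C[of u] have "\<bar>u a\<bar> + (\<Sum>b\<in>B. \<bar>u b\<bar>) \<le> ?K * norm x"
      by (simp add: s_def algebra_simps)
    then show ?thesis using insert.hyps by (simp add: x_def s_def)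
  qed
  moreover have "?K > 0" using d0 C0 by (intro add_pos_nonneg mult_nonneg_nonneg) auto
  ultimately show ?case by blast
qed

text \<open>The coefficient bound makes the coordinate functionals continuous. Most later arguments
  see a finite-dimensional space only through these functionals and the expansion of a
  vector.\<close>

lemma findim_coordinates:
  assumes "findim TYPE('a::real_normed_vector)"
  obtains B :: "'a::real_normed_vector set" and c :: "'a \<Rightarrow> 'a \<Rightarrow> real"
  where "finite B" and "\<And>b. b \<in> B \<Longrightarrow> bounded_linear (c b)" and "\<And>x. (\<Sum>b\<in>B. c b x *\<^sub>R b) = x"
proof -
  obtain B0 :: "'a set" where B0: "finite B0" "span B0 = UNIV"
    using assms by (auto simp: findim_def)
  obtain B where B: "B \<subseteq> B0" "independent B" "B0 \<subseteq> span B"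
    by (rule maximal_independent_subset)
  have "span B0 \<subseteq> span B" using B(3) by (rule span_minimal) (rule subspace_span)
  then have span: "span B = UNIV" using B0(2) by blast
  have "finite B" using B(1) B0(1) finite_subset by blast
  then obtain C where C0: "C > 0"
    and C: "\<And>u. (\<Sum>b\<in>B. \<bar>u b\<bar>) \<le> C * norm (\<Sum>b\<in>B. u b *\<^sub>R b)"
    using independent_coefficients_bounded B(2) by metis
  define c where "c = (\<lambda>b x. representation B x b)"
  have sum: "(\<Sum>b\<in>B. c b x *\<^sub>R b) = x" for x
    unfolding c_def using B span \<open>finite B\<close> by (intro sum_representation_eq) auto
  have "bounded_linear (c b)" if "b \<in> B" for b
  proof (rule bounded_linear_intro)
    show "c b (x + y) = c b x + c b y" for x y
      using B span by (simp add: c_def representation_add)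
    show "c b (r *\<^sub>R x) = r *\<^sub>R c b x" for r x
      using B span by (simp add: c_def representation_scale)
    fix x
    have "\<bar>c b x\<bar> \<le> (\<Sum>b\<in>B. \<bar>c b x\<bar>)"
      using that \<open>finite B\<close> by (intro member_le_sum) auto
    also have "\<dots> \<le> C * norm x" using C[of "\<lambda>b. c b x"] by (simp add: sum)
    finally show "norm (c b x) \<le> norm x * C" by (simp add: mult.commute)
  qed
  with \<open>finite B\<close> sum that show thesis by blast
qed

lemma findim_linear_bounded:
  fixes f :: "'a::real_normed_vector \<Rightarrow> 'b::real_normed_vector"
  assumes "findim TYPE('a)" and "linear f"
  shows "bounded_linear f"
proof -
  obtain B :: "'a set" and c where B: "finite B" "\<And>b. b \<in> B \<Longrightarrow> bounded_linear (c b)"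
    "\<And>x. (\<Sum>b\<in>B. c b x *\<^sub>R b) = x" by (rule findim_coordinates[OF assms(1)]) blast
  have "f (\<Sum>b\<in>B. c b x *\<^sub>R b) = f x" for x by (simp add: B(3))
  then have "(\<Sum>b\<in>B. c b x *\<^sub>R f b) = f x" for x
    by (simp add: linear_sum[OF assms(2)] linear_scale[OF assms(2)])
  then have eq: "(\<lambda>x. \<Sum>b\<in>B. c b x *\<^sub>R f b) = f" by (rule ext)
  have "bounded_linear (\<lambda>x. \<Sum>b\<in>B. c b x *\<^sub>R f b)"
    by (intro bounded_linear_sum bounded_linear_scaleR_const B(2))
  then show ?thesis unfolding eq .
qed

lemma findim_complete:
  assumes "findim TYPE('a::real_normed_vector)"
  shows "complete (UNIV :: 'a set)"
proof (rule completeI)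
  fix x :: "nat \<Rightarrow> 'a" assume "Cauchy x"
  obtain B :: "'a set" and c where B: "finite B" "\<And>b. b \<in> B \<Longrightarrow> bounded_linear (c b)"
    "\<And>x. (\<Sum>b\<in>B. c b x *\<^sub>R b) = x" by (rule findim_coordinates[OF assms]) blast
  have "\<forall>b\<in>B. \<exists>v. (\<lambda>n. c b (x n)) \<longlonglongrightarrow> v"
    using bounded_linear.Cauchy[OF B(2) \<open>Cauchy x\<close>]
    by (auto simp: Cauchy_convergent_iff convergent_def)
  then obtain v where v: "\<And>b. b \<in> B \<Longrightarrow> (\<lambda>n. c b (x n)) \<longlonglongrightarrow> v b" by metis
  have "(\<lambda>n. \<Sum>b\<in>B. c b (x n) *\<^sub>R b) \<longlonglongrightarrow> (\<Sum>b\<in>B. v b *\<^sub>R b)"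
    by (intro tendsto_intros v)
  then show "\<exists>l\<in>UNIV. x \<longlonglongrightarrow> l" by (auto simp: B(3))
qed

section \<open>Finite dimension of products and of spaces of linear maps\<close>

lemma findimI:
  fixes F :: "'i \<Rightarrow> 'a::real_normed_vector"
  assumes "finite I" and "\<And>x. \<exists>u. x = (\<Sum>i\<in>I. u i *\<^sub>R F i)"
  shows "findim TYPE('a)"
proof -
  have "x \<in> span (F ` I)" for x
  proof -
    obtain u where u: "x = (\<Sum>i\<in>I. u i *\<^sub>R F i)" using assms(2) by blast
    show ?thesis unfolding u by (intro span_sum span_scale span_base imageI)
  qed
  then have "span (F ` I) = UNIV" by blast
  with assms(1) show ?thesis unfolding findim_def by (metis finite_imageI)
qed

lemma findim_prod:
  assumes "findim TYPE('a::real_normed_vector)" and "findim TYPE('b::real_normed_vector)"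
  shows "findim TYPE('a \<times> 'b)"
proof -
  obtain A :: "'a set" where A: "finite A" "span A = UNIV" using assms(1) by (auto simp: findim_def)
  obtain B :: "'b set" where B: "finite B" "span B = UNIV" using assms(2) by (auto simp: findim_def)
  let ?S = "(\<lambda>a. (a, 0)) ` A \<union> (\<lambda>b. (0, b)) ` B"
  have l: "linear (\<lambda>a::'a. (a, 0::'b))" "linear (\<lambda>b::'b. (0::'a, b))"
    by (auto intro!: linearI)
  have "span ((\<lambda>a. (a, 0::'b)) ` A) = (\<lambda>a. (a, 0)) ` span A"
    "span ((\<lambda>b. (0::'a, b)) ` B) = (\<lambda>b. (0, b)) ` span B"
    by (intro linear_span_image l)+
  then have "range (\<lambda>a. (a, 0)) \<subseteq> span ?S" "range (\<lambda>b. (0, b)) \<subseteq> span ?S"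
    unfolding A(2) B(2) using span_mono[OF Un_upper1, of "(\<lambda>a. (a, 0)) ` A" "(\<lambda>b. (0, b)) ` B"]
      span_mono[OF Un_upper2, of "(\<lambda>b. (0, b)) ` B" "(\<lambda>a. (a, 0)) ` A"] by simp_all
  then have "(x, 0) + (0, y) \<in> span ?S" for x y by (intro span_add) auto
  then have "z \<in> span ?S" for z by (cases z) simp
  then have "span ?S = UNIV" by blast
  moreover have "finite ?S" using A B by simp
  ultimately show ?thesis unfolding findim_def by blast
qed

text \<open>The rank-one maps \<open>E (a, b)\<close>, a coordinate functional times a vector,
  span.\<close>

lemma findim_blinfun:
  assumes "findim TYPE('a::real_normed_vector)" and "findim TYPE('b::real_normed_vector)"
  shows "findim TYPE('a \<Rightarrow>\<^sub>L 'b)"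
proof -
  obtain A :: "'a set" and c where A: "finite A" "\<And>b. b \<in> A \<Longrightarrow> bounded_linear (c b)"
    "\<And>x. (\<Sum>b\<in>A. c b x *\<^sub>R b) = x" by (rule findim_coordinates[OF assms(1)]) blast
  obtain B :: "'b set" and d where B: "finite B" "\<And>b. b \<in> B \<Longrightarrow> bounded_linear (d b)"
    "\<And>x. (\<Sum>b\<in>B. d b x *\<^sub>R b) = x" by (rule findim_coordinates[OF assms(2)]) blast
  define E :: "'a \<times> 'b \<Rightarrow> 'a \<Rightarrow>\<^sub>L 'b"
    where "E = (\<lambda>(a, b). Blinfun (\<lambda>x. c a x *\<^sub>R b))"
  have E: "blinfun_apply (E (a, b)) x = c a x *\<^sub>R b" if "a \<in> A" for a b x
    unfolding E_def using A(2)[OF that]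
    by (simp add: bounded_linear_Blinfun_apply bounded_linear_scaleR_const)
  have "f = (\<Sum>p\<in>A \<times> B. d (snd p) (f (fst p)) *\<^sub>R E p)" for f :: "'a \<Rightarrow>\<^sub>L 'b"
  proof (rule blinfun_eqI)
    fix x
    have "blinfun_apply (\<Sum>p\<in>A \<times> B. d (snd p) (f (fst p)) *\<^sub>R E p) x
      = (\<Sum>a\<in>A. \<Sum>b\<in>B. d b (f a) *\<^sub>R c a x *\<^sub>R b)"
      by (simp add: sum.cartesian_product' blinfun.sum_left blinfun.scaleR_left E cong: sum.cong)
    also have "\<dots> = (\<Sum>a\<in>A. c a x *\<^sub>R (\<Sum>b\<in>B. d b (f a) *\<^sub>R b))"
      by (simp add: scaleR_sum_right mult.commute)
    also have "\<dots> = f (\<Sum>a\<in>A. c a x *\<^sub>R a)"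
      by (simp add: B(3) blinfun.sum_right blinfun.scaleR_right)
    finally show "f x = blinfun_apply (\<Sum>p\<in>A \<times> B. d (snd p) (f (fst p)) *\<^sub>R E p) x"
      by (simp add: A(3))
  qed
  then have "\<exists>u. f = (\<Sum>p\<in>A \<times> B. u p *\<^sub>R E p)" for f :: "'a \<Rightarrow>\<^sub>L 'b"
    by (rule exI[of _ "\<lambda>p. d (snd p) (f (fst p))"])
  from findimI[OF finite_cartesian_product[OF A(1) B(1)] this] show ?thesis .
qed

section \<open>Calculus of continuously differentiable maps\<close>

lemma Ck_on_cong:
  assumes "open S" and "\<And>x. x \<in> S \<Longrightarrow> f x = g x" and "Ck_on k S f"
  shows "Ck_on k S g"
  using assms(2,3)
proof (induction k arbitrary: f g)
  case 0
  then show ?case by (auto cong: continuous_on_cong)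
next
  case (Suc k)
  have D: "(g has_derivative frechet_derivative f (at x)) (at x)" if "x \<in> S" for x
  proof -
    have "(f has_derivative frechet_derivative f (at x)) (at x)"
      using Suc.prems that by (simp add: frechet_derivative_works)
    then show ?thesis
      using \<open>open S\<close> that Suc.prems(1) by (rule has_derivative_transform_within_open)
  qed
  have "Ck_on k S (\<lambda>x. frechet_derivative g (at x) v)" for v
  proof (rule Suc.IH)
    show "frechet_derivative f (at x) v = frechet_derivative g (at x) v" if "x \<in> S" for x
      using frechet_derivative_at[OF D[OF that]] by simp
    show "Ck_on k S (\<lambda>x. frechet_derivative f (at x) v)" using Suc.prems by simp
  qed
  then show ?case using D by (auto simp: differentiable_def)
qed

text \<open>Trades the derivative picked by \<open>frechet_derivative\<close> for an explicit one,
  which is how the product and chain rules become closure properties of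
  \<open>Ck_on\<close>.\<close>

lemma Ck_on_SucI:
  assumes "open S" and "\<And>x. x \<in> S \<Longrightarrow> (f has_derivative f' x) (at x)"
    and "\<And>v. Ck_on k S (\<lambda>x. f' x v)"
  shows "Ck_on (Suc k) S f"
proof -
  have "Ck_on k S (\<lambda>x. frechet_derivative f (at x) v)" for v
    using assms(1) _ assms(3)[of v]
    by (rule Ck_on_cong) (simp add: frechet_derivative_at[OF assms(2), symmetric])
  then show ?thesis using assms(2) by (auto simp: differentiable_def)
qed

lemma Ck_on_SucD:
  assumes "Ck_on (Suc k) S f"
  shows "x \<in> S \<Longrightarrow> (f has_derivative frechet_derivative f (at x)) (at x)"
    and "Ck_on k S (\<lambda>x. frechet_derivative f (at x) v)"
  using assms by (auto simp: frechet_derivative_works)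

lemma Ck_on_Suc_imp_Ck_on: "Ck_on (Suc k) S f \<Longrightarrow> Ck_on k S f"
proof (induction k arbitrary: f)
  case 0
  then show ?case
    using differentiable_imp_continuous_within[of f _ UNIV]
    by (auto intro: continuous_at_imp_continuous_on)
next
  case (Suc k)
  then show ?case by (metis Ck_on.simps(2))
qed

lemma Ck_on_imp_continuous_on: "Ck_on k S f \<Longrightarrow> continuous_on S f"
  by (induction k) (simp, blast dest: Ck_on_Suc_imp_Ck_on)

lemma Ck_on_const: "Ck_on k S (\<lambda>x. c)"
  by (induction k arbitrary: c) simp_all

lemma Ck_on_ident:
  assumes "open S"
  shows "Ck_on k S (\<lambda>x. x)"
proof (cases k)
  case (Suc n)
  then show ?thesis
    using Ck_on_SucI[OF assms has_derivative_ident Ck_on_const] by simp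
qed simp

lemma Ck_on_linear_compose:
  assumes "open S" and "bounded_linear L" and "Ck_on k S f"
  shows "Ck_on k S (\<lambda>x. L (f x))"
  using assms(3)
proof (induction k arbitrary: f)
  case 0
  then show ?case
    using bounded_linear.continuous_on[OF assms(2)] by auto
next
  case (Suc k)
  show ?case
    using assms(1) bounded_linear.has_derivative[OF assms(2) Ck_on_SucD(1)[OF Suc.prems]]
      Suc.IH[OF Ck_on_SucD(2)[OF Suc.prems]]
    by (rule Ck_on_SucI)
qed

lemma Ck_on_add:
  assumes "open S" and "Ck_on k S f" and "Ck_on k S g"
  shows "Ck_on k S (\<lambda>x. f x + g x)"
  using assms(2,3)
proof (induction k arbitrary: f g)
  case 0
  then show ?case by (simp add: continuous_on_add)
next
  case (Suc k)
  show ?case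
    using assms(1)
      has_derivative_add[OF Ck_on_SucD(1)[OF Suc.prems(1)] Ck_on_SucD(1)[OF Suc.prems(2)]]
      Suc.IH[OF Ck_on_SucD(2)[OF Suc.prems(1)] Ck_on_SucD(2)[OF Suc.prems(2)]]
    by (rule Ck_on_SucI)
qed

lemma Ck_on_diff:
  assumes "open S" and "Ck_on k S f" and "Ck_on k S g"
  shows "Ck_on k S (\<lambda>x. f x - g x)"
  using Ck_on_add[OF assms(1,2)
      Ck_on_linear_compose[OF assms(1) bounded_linear_minus[OF bounded_linear_ident] assms(3)]]
  by simp

lemma Ck_on_sum:
  assumes "open S" and "\<And>i. i \<in> I \<Longrightarrow> Ck_on k S (f i)"
  shows "Ck_on k S (\<lambda>x. \<Sum>i\<in>I. f i x)"
  using assms(2)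
proof (induction I rule: infinite_finite_induct)
  case (insert i I)
  then show ?case by (simp add: Ck_on_add[OF assms(1)])
qed (simp_all add: Ck_on_const)

lemma Ck_on_bilinear:
  assumes "open S" and "bounded_bilinear B" and "Ck_on k S f" and "Ck_on k S g"
  shows "Ck_on k S (\<lambda>x. B (f x) (g x))"
  using assms(3,4)
proof (induction k arbitrary: f g)
  case 0
  then show ?case using bounded_bilinear.continuous_on[OF assms(2)] by auto
next
  case (Suc k)
  have f: "Ck_on k S f" and g: "Ck_on k S g" using Suc.prems Ck_on_Suc_imp_Ck_on by blast+
  show ?case
    using assms(1)
      bounded_bilinear.FDERIV[OF assms(2) Ck_on_SucD(1)[OF Suc.prems(1)]
        Ck_on_SucD(1)[OF Suc.prems(2)]]
      Ck_on_add[OF assms(1) Suc.IH[OF f Ck_on_SucD(2)[OF Suc.prems(2)]]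
        Suc.IH[OF Ck_on_SucD(2)[OF Suc.prems(1)] g]]
    by (rule Ck_on_SucI)
qed

lemma Ck_on_Pair:
  assumes "open S" and "Ck_on k S f" and "Ck_on k S g"
  shows "Ck_on k S (\<lambda>x. (f x, g x))"
proof -
  have "Ck_on k S (\<lambda>x. (f x, 0) + (0, g x))"
    by (intro Ck_on_add assms Ck_on_linear_compose[where L = "\<lambda>x. (x, 0)"]
        Ck_on_linear_compose[where L = "\<lambda>x. (0, x)"] bounded_linear_Pair
        bounded_linear_ident bounded_linear_zero)
  then show ?thesis by simp
qed

text \<open>\<open>Ck_on\<close> controls derivatives of f in fixed directions, whereas the chain
  rule differentiates f in the direction Dg(x)v, which moves with x. Expanding this direction in
  coordinates of \<open>'b\<close> gives the finite sum F of products, each of whose factors is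
  covered by the induction hypothesis or by the assumption on g.\<close>

lemma Ck_on_compose:
  fixes f :: "'b::real_normed_vector \<Rightarrow> 'c::real_normed_vector"
    and g :: "'a::real_normed_vector \<Rightarrow> 'b"
  assumes fin: "findim TYPE('b)" and "open S" and "g ` S \<subseteq> T"
    and "Ck_on k T f" and "Ck_on k S g"
  shows "Ck_on k S (\<lambda>x. f (g x))"
  using assms(4,5)
proof (induction k arbitrary: f)
  case 0
  then show ?case using continuous_on_compose2[OF _ _ assms(3), of f] by simp
next
  case (Suc k)
  obtain B :: "'b set" and c where B: "finite B" "\<And>b. b \<in> B \<Longrightarrow> bounded_linear (c b)"
    "\<And>x. (\<Sum>b\<in>B. c b x *\<^sub>R b) = x" by (rule findim_coordinates[OF fin]) blast
  have gk: "Ck_on k S g" using Suc.prems(2) by (rule Ck_on_Suc_imp_Ck_on)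
  let ?D = "\<lambda>x. frechet_derivative g (at x)"
  define F where "F = (\<lambda>x v. \<Sum>b\<in>B. c b (?D x v) *\<^sub>R frechet_derivative f (at (g x)) b)"
  have der: "((\<lambda>x. f (g x)) has_derivative F x) (at x)" if "x \<in> S" for x
  proof -
    have f': "(f has_derivative frechet_derivative f (at (g x))) (at (g x))"
      using Suc.prems(1) assms(3) that by (intro Ck_on_SucD(1)) auto
    note lin = has_derivative_linear[OF f']
    have "frechet_derivative f (at (g x)) (\<Sum>b\<in>B. c b (?D x v) *\<^sub>R b) = F x v" for v
      by (simp add: F_def linear_sum[OF lin] linear_scale[OF lin])
    then have "frechet_derivative f (at (g x)) (?D x v) = F x v" for v by (simp only: B(3))
    then have "frechet_derivative f (at (g x)) \<circ> ?D x = F x" by auto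
    then show ?thesis
      using diff_chain_at[OF Ck_on_SucD(1)[OF Suc.prems(2) that] f'] by (simp add: o_def)
  qed
  have "Ck_on k S (\<lambda>x. F x v)" for v
    unfolding F_def
  proof (intro Ck_on_sum Ck_on_bilinear[OF _ bounded_bilinear_scaleR] assms(2))
    fix b assume "b \<in> B"
    show "Ck_on k S (\<lambda>x. c b (?D x v))"
      by (rule Ck_on_linear_compose[OF assms(2) B(2)[OF \<open>b \<in> B\<close>] Ck_on_SucD(2)[OF Suc.prems(2)]])
    show "Ck_on k S (\<lambda>x. frechet_derivative f (at (g x)) b)"
      by (rule Suc.IH[OF Ck_on_SucD(2)[OF Suc.prems(1)] gk])
  qed
  with assms(2) der show ?case by (rule Ck_on_SucI)
qed

section \<open>Smooth fixed points\<close>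

text \<open>R is the inverse of 1 - T. It comes from the contraction principle for
  \<open>b + T x\<close>; linearity follows from uniqueness of the fixed point, and the factor 2
  from absorbing \<open>norm (R b) / 2\<close>.\<close>

lemma contraction_linear_equation:
  fixes T :: "'v::real_normed_vector \<Rightarrow> 'v"
  assumes "complete (UNIV :: 'v set)" and "linear T" and T: "\<And>u. norm (T u) \<le> norm u / 2"
  obtains R where "linear R" and "\<And>b. R b = b + T (R b)" and "\<And>b. norm (R b) \<le> 2 * norm b"
proof -
  have "dist (b + T x) (b + T y) \<le> 1 / 2 * dist x y" for b x y
    using T[of "x - y"] by (simp add: dist_norm linear_diff[OF assms(2)])
  then have ex1: "\<exists>!x. b + T x = x" for b
    using Banach_fix[OF assms(1), of "1 / 2" "\<lambda>x. b + T x"] by simp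
  then obtain R where R: "\<And>b. b + T (R b) = R b" by metis
  then have uniq: "x = R b" if "b + T x = x" for x b using ex1 that by metis
  show thesis
  proof
    show "linear R"
    proof (rule linearI)
      fix x y show "R (x + y) = R x + R y"
        using arg_cong2[OF R[of x] R[of y], of plus]
        by (intro uniq[symmetric]) (simp add: linear_add[OF assms(2)] algebra_simps)
    next
      fix r x show "R (r *\<^sub>R x) = r *\<^sub>R R x"
        using arg_cong[OF R[of x], of "scaleR r"]
        by (intro uniq[symmetric]) (simp add: linear_scale[OF assms(2)] algebra_simps)
    qed
    show "R b = b + T (R b)" for b using R by simp
    show "norm (R b) \<le> 2 * norm b" for b
      using norm_triangle_ineq[of b "T (R b)"] T[of "R b"] R[of b] by simp
  qed
qed

text \<open>Moving from p to q changes g both through its value and through the parameter. The first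
  change is at most half of the total and is absorbed, so the total is at most twice the
  second.\<close>

lemma continuous_fixpoint:
  fixes g :: "'p::metric_space \<Rightarrow> 'v::real_normed_vector"
  assumes fixp: "\<And>q. q \<in> S \<Longrightarrow> g q = F q (g q)" and "p \<in> S"
    and contr: "\<And>q. q \<in> S \<Longrightarrow> norm (F q (g q) - F q (g p)) \<le> norm (g q - g p) / 2"
    and cont: "continuous (at p within S) (\<lambda>q. F q (g p))"
  shows "continuous (at p within S) g"
  unfolding continuous_within_eps_delta
proof (intro allI impI)
  fix e :: real assume "e > 0"
  then have "e / 2 > 0" by simp
  then obtain d where "d > 0"
    and d: "\<And>q. q \<in> S \<Longrightarrow> dist q p < d \<Longrightarrow> dist (F q (g p)) (F p (g p)) < e / 2"
    using cont unfolding continuous_within_eps_delta by blast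
  have "dist (g q) (g p) < e" if "q \<in> S" "dist q p < d" for q
  proof -
    have "g q - g p = (F q (g q) - F q (g p)) + (F q (g p) - F p (g p))"
      using fixp[OF that(1)] fixp[OF \<open>p \<in> S\<close>] by simp
    then have "norm (g q - g p) \<le> norm (g q - g p) / 2 + norm (F q (g p) - F p (g p))"
      using norm_triangle_ineq contr[OF that(1)] by (smt (verit))
    then show ?thesis using d[OF that] by (simp add: dist_norm)
  qed
  then show "\<exists>d>0. \<forall>q\<in>S. dist q p < d \<longrightarrow> dist (g q) (g p) < e" using \<open>d > 0\<close> by blast
qed

text \<open>Formal differentiation of the fixed-point equation gives D v = \<Psi>'(D v, v), which is
  solved by inverting 1 - \<Psi>'(., 0). The error of this candidate D satisfies the same linear
  equation with the remainder of \<Psi> as inhomogeneous term, so it is at most twice that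
  remainder.\<close>

lemma fixpoint_has_derivative:
  fixes g :: "'p::real_normed_vector \<Rightarrow> 'v::real_normed_vector"
  assumes "complete (UNIV :: 'v set)" and "open S" and "p \<in> S"
    and fixp: "\<And>q. q \<in> S \<Longrightarrow> g q = \<Psi> (g q, q)"
    and der: "(\<Psi> has_derivative \<Psi>') (at (g p, p))"
    and contr: "\<And>u. norm (\<Psi>' (u, 0)) \<le> norm u / 2"
    and cont: "continuous (at p) g"
  obtains D where "(g has_derivative D) (at p)" and "\<And>v. D v = \<Psi>' (D v, v)"
proof -
  have lin: "linear \<Psi>'" using der by (rule has_derivative_linear)
  have split: "\<Psi>' (u, v) = \<Psi>' (u, 0) + \<Psi>' (0, v)" for u v
    using linear_add[OF lin, of "(u, 0)" "(0, v)"] by simp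
  have linT: "linear (\<lambda>u. \<Psi>' (u, 0))"
    using linear_add[OF lin, of "(_, 0)" "(_, 0)"] linear_scale[OF lin, of _ "(_, 0)"]
    by (intro linearI) simp_all
  obtain R where R: "linear R" "\<And>b. R b = b + \<Psi>' (R b, 0)" "\<And>b. norm (R b) \<le> 2 * norm b"
    using contraction_linear_equation[OF assms(1) linT contr] by blast
  obtain K where "K > 0" and K': "\<And>w. norm (\<Psi>' w) \<le> norm w * K"
    using bounded_linear.pos_bounded[OF has_derivative_bounded_linear[OF der]] by blast
  have K: "norm (\<Psi>' (0, v)) \<le> K * norm v" for v
    using K'[of "(0, v)"] by (simp add: norm_Pair mult.commute)
  define D where "D = (\<lambda>v. R (\<Psi>' (0, v)))"
  have D: "D v = \<Psi>' (D v, v)" for v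
    using R(2)[of "\<Psi>' (0, v)"] split[of "D v" v] by (simp add: D_def add.commute)
  have "bounded_linear D"
  proof (rule bounded_linear_intro)
    show "D (x + y) = D x + D y" for x y
      using linear_add[OF lin, of "(0, x)" "(0, y)"] by (simp add: D_def linear_add[OF R(1)])
    show "D (r *\<^sub>R x) = r *\<^sub>R D x" for r x
      using linear_scale[OF lin, of r "(0, x)"] by (simp add: D_def linear_scale[OF R(1)])
    show "norm (D v) \<le> norm v * (2 * K)" for v
      using R(3)[of "\<Psi>' (0, v)"] K[of v] by (simp add: D_def algebra_simps)
  qed
  moreover have "\<exists>d>0. \<forall>q. norm (q - p) < d \<longrightarrow> norm (g q - g p - D (q - p)) \<le> e * norm (q - p)"
    if "e > 0" for e
  proof -
    \<comment> \<open>The bound 1/4 lets the remainder be absorbed, which yields norm \<delta> \<le>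
      (4 K + 1) norm \<eta> for the increments \<delta> of g and \<eta> of the parameter. The final
      estimate is then 2 e' ((4 K + 1) + 1) norm \<eta>, whence 8 K + 4.\<close>
    define e' where "e' = min (1 / 4) (e / (8 * K + 4))"
    have "e' \<le> e / (8 * K + 4)" unfolding e'_def by (rule min.cobounded2)
    then have e'3: "e' * (8 * K + 4) \<le> e"
      using \<open>K > 0\<close> by (simp add: pos_le_divide_eq)
    have e'2: "e' \<le> 1 / 4" unfolding e'_def by (rule min.cobounded1)
    have e'1: "e' > 0" using that \<open>K > 0\<close> by (simp add: e'_def)
    obtain d where "d > 0" and d: "\<And>w. norm (w - (g p, p)) < d \<Longrightarrow>
        norm (\<Psi> w - \<Psi> (g p, p) - \<Psi>' (w - (g p, p))) \<le> e' * norm (w - (g p, p))"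
      using der e'1 unfolding has_derivative_at_alt by blast
    have "continuous (at p) (\<lambda>q. (g q, q))" using cont by (intro continuous_Pair) auto
    then obtain d1 where "d1 > 0" and d1: "\<And>q. norm (q - p) < d1 \<Longrightarrow> norm ((g q, q) - (g p, p)) < d"
      using \<open>d > 0\<close> unfolding continuous_at_eps_delta dist_norm by blast
    obtain d2 where "d2 > 0" and "ball p d2 \<subseteq> S" using assms(2,3) openE by blast
    then have d2: "q \<in> S" if "norm (q - p) < d2" for q
      using that by (auto simp: subset_iff dist_norm norm_minus_commute)
    have "norm (g q - g p - D (q - p)) \<le> e * norm (q - p)"
      if q: "norm (q - p) < min d1 d2" for q
    proof -
      let ?\<delta> = "g q - g p" and ?\<eta> = "q - p"
      let ?\<epsilon> = "?\<delta> - D ?\<eta>"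
      define rem where "rem = ?\<delta> - \<Psi>' (?\<delta>, ?\<eta>)"
      have "norm rem \<le> e' * norm ((g q, q) - (g p, p))"
        using d[of "(g q, q)"] d1[of q] d2[of q] q fixp[of q] fixp[of p] \<open>p \<in> S\<close>
        by (simp add: rem_def)
      also have "\<dots> \<le> e' * (norm ?\<delta> + norm ?\<eta>)"
        using e'1 norm_Pair_le[of ?\<delta> ?\<eta>] by (simp add: mult_left_mono)
      finally have rem: "norm rem \<le> e' * (norm ?\<delta> + norm ?\<eta>)" .
      also have "\<dots> \<le> 1 / 4 * (norm ?\<delta> + norm ?\<eta>)"
        using e'2 by (intro mult_right_mono) auto
      finally have rem4: "norm rem \<le> (norm ?\<delta> + norm ?\<eta>) / 4" by simp
      have "?\<delta> = \<Psi>' (?\<delta>, 0) + \<Psi>' (0, ?\<eta>) + rem"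
        using split[of ?\<delta> ?\<eta>] by (simp add: rem_def)
      then have "norm ?\<delta> \<le> norm (\<Psi>' (?\<delta>, 0)) + norm (\<Psi>' (0, ?\<eta>)) + norm rem"
        by (metis norm_triangle_ineq norm_triangle_mono order_refl)
      then have \<delta>: "norm ?\<delta> \<le> (4 * K + 1) * norm ?\<eta>"
        using contr[of ?\<delta>] K[of ?\<eta>] rem4 by (simp add: algebra_simps)
      have "\<Psi>' (?\<epsilon>, 0) = \<Psi>' (?\<delta>, ?\<eta>) - \<Psi>' (D ?\<eta>, ?\<eta>)"
        using linear_diff[OF lin, of "(?\<delta>, ?\<eta>)" "(D ?\<eta>, ?\<eta>)"] by simp
      then have "?\<epsilon> = \<Psi>' (?\<epsilon>, 0) + rem"
        using D[of ?\<eta>] by (simp add: rem_def)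
      then have "norm ?\<epsilon> \<le> norm ?\<epsilon> / 2 + norm rem"
        using norm_triangle_ineq[of "\<Psi>' (?\<epsilon>, 0)" rem] contr[of ?\<epsilon>] by simp
      then have "norm ?\<epsilon> \<le> 2 * norm rem" by simp
      also have "\<dots> \<le> 2 * (e' * ((4 * K + 1) * norm ?\<eta> + norm ?\<eta>))"
        using rem \<delta> e'1 by (smt (verit) mult_left_mono)
      also have "\<dots> = e' * (8 * K + 4) * norm ?\<eta>" by (simp add: algebra_simps)
      also have "\<dots> \<le> e * norm ?\<eta>" using e'3 by (simp add: mult_right_mono)
      finally show ?thesis .
    qed
    then show ?thesis using \<open>d1 > 0\<close> \<open>d2 > 0\<close> by (intro exI[of _ "min d1 d2"]) simp
  qed
  ultimately have "(g has_derivative D) (at p)" unfolding has_derivative_at_alt by blast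
  then show thesis using D that by blast
qed


text \<open>Differentiating the equation produces an equation of the same shape for the derivative:
  the operator with columns \<open>A i\<close> is unchanged, and only the inhomogeneous term is new,
  with one order of smoothness less. Hence the induction on k is over all a and g. The operator is
  written in coordinates because \<open>Ck_on\<close> speaks of vectors for fixed directions, not of
  operators.\<close>

lemma Ck_on_linear_fixpoint:
  fixes g :: "'p::real_normed_vector \<Rightarrow> 'v::real_normed_vector" and c :: "'i \<Rightarrow> 'v \<Rightarrow> real"
  assumes "complete (UNIV :: 'v set)" and "open S"
    and c: "\<And>i. i \<in> I \<Longrightarrow> bounded_linear (c i)"
    and A: "\<And>i. i \<in> I \<Longrightarrow> Ck_on k S (A i)"
    and a: "Ck_on k S a"
    and fixp: "\<And>p. p \<in> S \<Longrightarrow> g p = a p + (\<Sum>i\<in>I. c i (g p) *\<^sub>R A i p)"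
    and contr: "\<And>p u. p \<in> S \<Longrightarrow> norm (\<Sum>i\<in>I. c i u *\<^sub>R A i p) \<le> norm u / 2"
  shows "Ck_on k S g"
  using A a fixp
proof (induction k arbitrary: a g)
  case 0
  have "continuous (at p within S) g" if "p \<in> S" for p
  proof (rule continuous_fixpoint[where F = "\<lambda>q x. a q + (\<Sum>i\<in>I. c i x *\<^sub>R A i q)"])
    show "p \<in> S" by fact
    show "g q = a q + (\<Sum>i\<in>I. c i (g q) *\<^sub>R A i q)" if "q \<in> S" for q
      using 0(3) that .
    show "norm (a q + (\<Sum>i\<in>I. c i (g q) *\<^sub>R A i q) - (a q + (\<Sum>i\<in>I. c i (g p) *\<^sub>R A i q)))
        \<le> norm (g q - g p) / 2" if "q \<in> S" for q
      using contr[OF that, of "g q - g p"]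
      by (simp add: linear_diff[OF bounded_linear.linear[OF c]] scaleR_left_diff_distrib
          sum_subtractf cong: sum.cong)
    show "continuous (at p within S) (\<lambda>q. a q + (\<Sum>i\<in>I. c i (g p) *\<^sub>R A i q))"
      using 0(1,2) \<open>p \<in> S\<close>
      by (intro continuous_intros) (auto simp: continuous_on_eq_continuous_within)
  qed
  then show ?case by (simp add: continuous_on_eq_continuous_within)
next
  case (Suc k)
  have Ak: "Ck_on k S (A i)" if "i \<in> I" for i
    using Suc.prems(1)[OF that] by (rule Ck_on_Suc_imp_Ck_on)
  have gk: "Ck_on k S g"
    using Suc.IH[OF Ak Ck_on_Suc_imp_Ck_on[OF Suc.prems(2)] Suc.prems(3)] by blast
  then have cont: "continuous (at p) g" if "p \<in> S" for p
    using that Ck_on_imp_continuous_on continuous_on_eq_continuous_at[OF \<open>open S\<close>] by blast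
  let ?A' = "\<lambda>i p. frechet_derivative (A i) (at p)"
  let ?a' = "\<lambda>p. frechet_derivative a (at p)"
  have "\<exists>D. (g has_derivative D) (at p) \<and>
      (\<forall>v. D v = ?a' p v + (\<Sum>i\<in>I. c i (g p) *\<^sub>R ?A' i p v) + (\<Sum>i\<in>I. c i (D v) *\<^sub>R A i p))"
    if pS: "p \<in> S" for p
  proof -
    let ?\<Psi>' = "\<lambda>w. ?a' p (snd w)
      + (\<Sum>i\<in>I. c i (g p) *\<^sub>R ?A' i p (snd w) + c i (fst w) *\<^sub>R A i p)"
    have der: "((\<lambda>w. a (snd w) + (\<Sum>i\<in>I. c i (fst w) *\<^sub>R A i (snd w))) has_derivative ?\<Psi>') (at (g p, p))"
    proof (intro has_derivative_add has_derivative_sum)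
      have snd: "(snd has_derivative snd) (at (g p, p))" "(fst has_derivative fst) (at (g p, p))"
        by (auto intro: bounded_linear_imp_has_derivative bounded_linear_fst bounded_linear_snd)
      show "((\<lambda>w. a (snd w)) has_derivative (\<lambda>w. ?a' p (snd w))) (at (g p, p))"
        using has_derivative_compose[OF snd(1)] Ck_on_SucD(1)[OF Suc.prems(2) \<open>p \<in> S\<close>] by simp
      fix i assume "i \<in> I"
      have 1: "((\<lambda>w. A i (snd w)) has_derivative (\<lambda>w. ?A' i p (snd w))) (at (g p, p))"
        using has_derivative_compose[OF snd(1)] Ck_on_SucD(1)[OF Suc.prems(1)[OF \<open>i \<in> I\<close>] \<open>p \<in> S\<close>]
        by simp
      have 2: "((\<lambda>w. c i (fst w)) has_derivative (\<lambda>w. c i (fst w))) (at (g p, p))"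
        by (rule bounded_linear.has_derivative[OF c[OF \<open>i \<in> I\<close>] snd(2)])
      show "((\<lambda>w. c i (fst w) *\<^sub>R A i (snd w)) has_derivative
          (\<lambda>w. c i (g p) *\<^sub>R ?A' i p (snd w) + c i (fst w) *\<^sub>R A i p)) (at (g p, p))"
        using has_derivative_scaleR[OF 2 1] by simp
    qed
    \<comment> \<open>In a direction \<open>(u, 0)\<close> every derivative with respect to the
      parameter drops out, which leaves exactly the sum bounded by \<open>contr\<close>.\<close>
    have zero: "?a' p 0 = 0" "i \<in> I \<Longrightarrow> ?A' i p 0 = 0" for i
      using linear_0[OF has_derivative_linear[OF Ck_on_SucD(1)[OF Suc.prems(2) that]]]
        linear_0[OF has_derivative_linear[OF Ck_on_SucD(1)[OF Suc.prems(1) that]]] by auto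
    have "norm (?\<Psi>' (u, 0)) \<le> norm u / 2" for u
      using contr[OF that, of u] by (simp add: zero cong: sum.cong)
    then obtain D where D: "(g has_derivative D) (at p)" "\<And>v. D v = ?\<Psi>' (D v, v)"
      using fixpoint_has_derivative[OF assms(1,2) pS _ der _ cont[OF pS]] Suc.prems(3) by auto
    have "?\<Psi>' (D v, v)
      = ?a' p v + (\<Sum>i\<in>I. c i (g p) *\<^sub>R ?A' i p v) + (\<Sum>i\<in>I. c i (D v) *\<^sub>R A i p)" for v
      by (simp add: sum.distrib add.assoc)
    then show ?thesis using D(1) trans[OF D(2)] by blast
  qed
  then have "\<exists>D. \<forall>p\<in>S. (g has_derivative D p) (at p) \<and>
      (\<forall>v. D p v = ?a' p v + (\<Sum>i\<in>I. c i (g p) *\<^sub>R ?A' i p v) + (\<Sum>i\<in>I. c i (D p v) *\<^sub>R A i p))"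
    by (intro bchoice ballI)
  then obtain D where D: "\<And>p. p \<in> S \<Longrightarrow> (g has_derivative D p) (at p)"
    "\<And>p v. p \<in> S \<Longrightarrow> D p v = ?a' p v + (\<Sum>i\<in>I. c i (g p) *\<^sub>R ?A' i p v) + (\<Sum>i\<in>I. c i (D p v) *\<^sub>R A i p)"
    by blast
  have "Ck_on k S (\<lambda>p. D p v)" for v
  proof (rule Suc.IH[OF Ak _ D(2)])
    show "Ck_on k S (\<lambda>p. ?a' p v + (\<Sum>i\<in>I. c i (g p) *\<^sub>R ?A' i p v))"
      by (intro Ck_on_add Ck_on_sum Ck_on_bilinear[OF _ bounded_bilinear_scaleR] assms(2)
          Ck_on_SucD(2)[OF Suc.prems(2)] Ck_on_SucD(2)[OF Suc.prems(1)]
          Ck_on_linear_compose[OF assms(2) c gk])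
  qed
  with \<open>open S\<close> D(1) show ?case by (rule Ck_on_SucI)
qed

text \<open>Bootstrapping: the derivative of g solves a linear fixed-point equation whose
  coefficients are derivatives of \<Psi> along the graph of g. They are of class k as soon as g is,
  so the derivative of g is of class k and g gains one order.\<close>

lemma Ck_on_fixpoint:
  fixes g :: "'p::real_normed_vector \<Rightarrow> 'v::real_normed_vector"
  assumes findim: "findim TYPE('v)" "findim TYPE('p)" and "open S"
    and smooth: "smooth_on UNIV \<Psi>"
    and fixp: "\<And>q. q \<in> S \<Longrightarrow> g q = \<Psi> (g q, q)"
    and contr: "\<And>q u. q \<in> S \<Longrightarrow> norm (frechet_derivative \<Psi> (at (g q, q)) (u, 0)) \<le> norm u / 2"
    and cont: "continuous_on S g"
  shows "Ck_on k S g"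
proof (induction k)
  case 0
  then show ?case using cont by simp
next
  case (Suc k)
  note complete = findim_complete[OF findim(1)]
  have Ck\<Psi>: "Ck_on (Suc n) UNIV \<Psi>" for n using smooth unfolding smooth_on_def by blast
  obtain B :: "'v set" and c where B: "finite B" "\<And>b. b \<in> B \<Longrightarrow> bounded_linear (c b)"
    "\<And>x. (\<Sum>b\<in>B. c b x *\<^sub>R b) = x" by (rule findim_coordinates[OF findim(1)]) blast
  let ?\<Psi>' = "\<lambda>z. frechet_derivative \<Psi> (at z)"
  have der: "(\<Psi> has_derivative ?\<Psi>' z) (at z)" for z
    by (rule Ck_on_SucD(1)[OF Ck\<Psi>]) simp
  have expand: "?\<Psi>' z (u, v) = ?\<Psi>' z (0, v) + (\<Sum>b\<in>B. c b u *\<^sub>R ?\<Psi>' z (b, 0))" for z u v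
  proof -
    note lin = has_derivative_linear[OF der[of z]]
    have "(u, v) = (0, v) + (\<Sum>b\<in>B. c b u *\<^sub>R (b, 0))"
      by (simp add: prod_eq_iff fst_sum snd_sum B(3))
    then show ?thesis by (simp only: linear_add[OF lin] linear_sum[OF lin] linear_scale[OF lin])
  qed
  have "\<exists>D. (g has_derivative D) (at p) \<and> (\<forall>v. D v = ?\<Psi>' (g p, p) (D v, v))" if "p \<in> S" for p
    using fixpoint_has_derivative[OF complete \<open>open S\<close> that fixp der contr[OF that]]
      cont that \<open>open S\<close> by (metis continuous_on_eq_continuous_at)
  then obtain D where D: "\<And>p. p \<in> S \<Longrightarrow> (g has_derivative D p) (at p)"
    "\<And>p v. p \<in> S \<Longrightarrow> D p v = ?\<Psi>' (g p, p) (D p v, v)" by metis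
  have pair: "Ck_on k S (\<lambda>p. ?\<Psi>' (g p, p) w)" for w
    by (rule Ck_on_compose[OF findim_prod[OF findim] \<open>open S\<close> subset_UNIV Ck_on_SucD(2)[OF Ck\<Psi>]])
      (intro Ck_on_Pair \<open>open S\<close> Suc.IH Ck_on_ident)
  have "Ck_on k S (\<lambda>p. D p v)" for v
  proof (rule Ck_on_linear_fixpoint[OF complete \<open>open S\<close> B(2) pair pair])
    show "D p v = ?\<Psi>' (g p, p) (0, v) + (\<Sum>b\<in>B. c b (D p v) *\<^sub>R ?\<Psi>' (g p, p) (b, 0))"
      if "p \<in> S" for p using D(2)[OF that, of v] expand by metis
    show "norm (\<Sum>b\<in>B. c b u *\<^sub>R ?\<Psi>' (g p, p) (b, 0)) \<le> norm u / 2" if "p \<in> S" for p u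
      using contr[OF that, of u] expand[of "(g p, p)" u 0]
        linear_0[OF has_derivative_linear[OF der]] by (simp flip: zero_prod_def)
  qed
  with \<open>open S\<close> D(1) show ?case by (rule Ck_on_SucI)
qed

text \<open>
  The implicit function theorem in fixed-point form: no complement of a kernel and no inverse of
  a derivative enters, because \<open>\<Psi>\<close> is stationary in its first argument at the base point.
\<close>

theorem smooth_fixpoint:
  fixes \<Psi> :: "'v::real_normed_vector \<times> 'p::real_normed_vector \<Rightarrow> 'v"
  assumes findim: "findim TYPE('v)" "findim TYPE('p)"
    and smooth: "smooth_on UNIV \<Psi>"
    and base: "\<Psi> (x0, p0) = x0"
    and stat: "\<And>u. frechet_derivative \<Psi> (at (x0, p0)) (u, 0) = 0"
  obtains U \<phi> where "open U" and "p0 \<in> U" and "smooth_on U \<phi>" and "\<phi> p0 = x0"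
    and "\<And>p. p \<in> U \<Longrightarrow> \<phi> p = \<Psi> (\<phi> p, p)"
proof -
  note complete = findim_complete[OF findim(1)]
  have Ck\<Psi>: "Ck_on n UNIV \<Psi>" for n using smooth unfolding smooth_on_def by blast
  obtain B :: "'v set" and c where B: "finite B" "\<And>b. b \<in> B \<Longrightarrow> bounded_linear (c b)"
    "\<And>x. (\<Sum>b\<in>B. c b x *\<^sub>R b) = x" by (rule findim_coordinates[OF findim(1)]) blast
  have "\<forall>b\<in>B. \<exists>K. \<forall>x. norm (c b x) \<le> norm x * K"
    using bounded_linear.bounded[OF B(2)] by blast
  then have "\<exists>K. \<forall>b\<in>B. \<forall>x. norm (c b x) \<le> norm x * K b" by (rule bchoice)
  then obtain K where K: "\<And>b x. b \<in> B \<Longrightarrow> \<bar>c b x\<bar> \<le> norm x * K b" by auto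
  let ?\<Psi>' = "\<lambda>z. frechet_derivative \<Psi> (at z)"
  have der: "(\<Psi> has_derivative ?\<Psi>' z) (at z)" for z
    by (rule Ck_on_SucD(1)[OF Ck\<Psi>]) simp
  \<comment> \<open>A continuous majorant for the norm of the partial derivative in the first
    argument. It is assembled from finitely many directional derivatives, since continuity is known
    direction by direction only.\<close>
  define m where "m = (\<lambda>z. \<Sum>b\<in>B. K b * norm (?\<Psi>' z (b, 0)))"
  have m: "norm (?\<Psi>' z (u, 0)) \<le> norm u * m z" for z u
  proof -
    note lin = has_derivative_linear[OF der[of z]]
    have "(u, 0) = (\<Sum>b\<in>B. c b u *\<^sub>R (b, 0 :: 'p))"
      by (simp add: prod_eq_iff fst_sum snd_sum B(3))
    then have "?\<Psi>' z (u, 0) = (\<Sum>b\<in>B. c b u *\<^sub>R ?\<Psi>' z (b, 0))"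
      by (simp only: linear_sum[OF lin] linear_scale[OF lin])
    then have "norm (?\<Psi>' z (u, 0)) \<le> (\<Sum>b\<in>B. norm (c b u *\<^sub>R ?\<Psi>' z (b, 0)))"
      by (simp only: norm_sum)
    also have "\<dots> = (\<Sum>b\<in>B. \<bar>c b u\<bar> * norm (?\<Psi>' z (b, 0)))" by simp
    also have "\<dots> \<le> (\<Sum>b\<in>B. norm u * K b * norm (?\<Psi>' z (b, 0)))"
      by (intro sum_mono mult_right_mono K) auto
    also have "\<dots> = norm u * m z" by (simp add: m_def sum_distrib_left mult.assoc)
    finally show ?thesis .
  qed
  have "continuous_on UNIV (\<lambda>z. ?\<Psi>' z w)" for w
    using Ck_on_SucD(2)[OF Ck\<Psi>[of "Suc 0"]] by simp
  then have "continuous_on UNIV m" unfolding m_def by (intro continuous_intros)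
  then have "continuous (at (x0, p0)) m" by (simp add: continuous_on_eq_continuous_at)
  then obtain d where "d > 0" and "\<And>z. dist z (x0, p0) < d \<Longrightarrow> dist (m z) (m (x0, p0)) < 1 / 2"
    using half_gt_zero[OF zero_less_one] unfolding continuous_at_eps_delta by blast
  moreover have "m (x0, p0) = 0" by (simp add: m_def stat)
  ultimately have d: "\<bar>m z\<bar> < 1 / 2" if "dist z (x0, p0) < d" for z
    using that by (simp add: dist_real_def)
  \<comment> \<open>The two increments add up to at most 2 r, which is below d.\<close>
  define r where "r = d / 3"
  have "r > 0" using \<open>d > 0\<close> by (simp add: r_def)
  have half: "norm (?\<Psi>' (x, p) (u, 0)) \<le> norm u / 2"
    if "x \<in> cball x0 r" "p \<in> ball p0 r" for x p u
  proof -
    have "norm ((x, p) - (x0, p0)) \<le> norm (x - x0) + norm (p - p0)"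
      using norm_Pair_le[of "x - x0" "p - p0"] by simp
    also have "\<dots> < d"
      using that \<open>d > 0\<close> by (simp add: r_def dist_norm norm_minus_commute)
    finally have "\<bar>m (x, p)\<bar> < 1 / 2" by (intro d) (simp add: dist_norm)
    then have "norm u * m (x, p) \<le> norm u * (1 / 2)" by (intro mult_left_mono) auto
    then show ?thesis using m[of "(x, p)" u] by simp
  qed
  have lip: "norm (\<Psi> (x, p) - \<Psi> (y, p)) \<le> norm (x - y) / 2"
    if "x \<in> cball x0 r" "y \<in> cball x0 r" "p \<in> ball p0 r" for x y p
  proof -
    have "norm (\<Psi> (x, p) - \<Psi> (y, p)) \<le> 1 / 2 * norm (x - y)"
    proof (rule differentiable_bound[where f' = "\<lambda>x u. ?\<Psi>' (x, p) (u, 0)" and S = "cball x0 r"])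
      show "((\<lambda>x. \<Psi> (x, p)) has_derivative (\<lambda>u. ?\<Psi>' (x, p) (u, 0))) (at x within cball x0 r)" for x
        using has_derivative_compose[OF has_derivative_Pair[OF has_derivative_ident
              has_derivative_const[of p]] der] by simp
      show "onorm (\<lambda>u. ?\<Psi>' (x, p) (u, 0)) \<le> 1 / 2" if "x \<in> cball x0 r" for x
        using half[OF that \<open>p \<in> ball p0 r\<close>] by (intro onorm_bound) auto
    qed (use that in auto)
    then show ?thesis by simp
  qed
  have cont\<Psi>: "isCont (\<lambda>p. \<Psi> (x, p)) q" for x q
    using continuous_on_compose2[OF Ck_on_imp_continuous_on[OF Ck\<Psi>],
        of UNIV "\<lambda>p. (x, p)"]
    by (simp add: continuous_on_eq_continuous_at continuous_on_Pair continuous_on_id)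
  \<comment> \<open>Half of r is reserved for moving the parameter at x0. The contraction spends at
    most the other half, so the closed ball of radius r is mapped into itself.\<close>
  from cont\<Psi>[of p0 x0] obtain s
    where "s > 0" and s: "\<And>p. dist p p0 < s \<Longrightarrow> dist (\<Psi> (x0, p)) x0 < r / 2"
    using half_gt_zero[OF \<open>r > 0\<close>] unfolding continuous_at_eps_delta base by blast
  define U where "U = ball p0 (min r s)"
  have Ur: "p \<in> ball p0 r" if "p \<in> U" for p using that by (simp add: U_def)
  have ex1: "\<exists>!x. x \<in> cball x0 r \<and> \<Psi> (x, p) = x" if "p \<in> U" for p
  proof (rule Banach_fix[where c = "1 / 2"])
    show "complete (cball x0 r)"
      using complete_Int_closed[OF complete closed_cball] by simp
    show "cball x0 r \<noteq> {}" using \<open>r > 0\<close> by simp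
    show "dist (\<Psi> (x, p)) (\<Psi> (y, p)) \<le> 1 / 2 * dist x y"
      if "x \<in> cball x0 r" "y \<in> cball x0 r" for x y
      using lip[OF that Ur[OF \<open>p \<in> U\<close>]] by (simp add: dist_norm)
    show "(\<lambda>x. \<Psi> (x, p)) ` cball x0 r \<subseteq> cball x0 r"
    proof (intro image_subsetI)
      fix x assume x: "x \<in> cball x0 r"
      have "dist (\<Psi> (x0, p)) x0 < r / 2" using \<open>p \<in> U\<close> by (intro s) (simp add: U_def dist_commute)
      moreover have "dist (\<Psi> (x, p)) (\<Psi> (x0, p)) \<le> r / 2"
        using lip[OF x _ Ur[OF \<open>p \<in> U\<close>], of x0] x \<open>r > 0\<close>
        by (simp add: dist_norm norm_minus_commute)
      ultimately have "dist (\<Psi> (x, p)) x0 \<le> r"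
        using dist_triangle[of "\<Psi> (x, p)" x0 "\<Psi> (x0, p)"] by linarith
      then show "\<Psi> (x, p) \<in> cball x0 r" by (simp add: dist_commute)
    qed
  qed auto
  define \<phi> where "\<phi> = (\<lambda>p. THE x. x \<in> cball x0 r \<and> \<Psi> (x, p) = x)"
  have \<phi>: "\<phi> p \<in> cball x0 r" "\<Psi> (\<phi> p, p) = \<phi> p" if "p \<in> U" for p
    using theI'[OF ex1[OF that]] by (simp_all add: \<phi>_def)
  have U: "open U" "p0 \<in> U" using \<open>r > 0\<close> \<open>s > 0\<close> by (auto simp: U_def)
  have "continuous (at p within U) \<phi>" if "p \<in> U" for p
  proof (rule continuous_fixpoint[where F = "\<lambda>q x. \<Psi> (x, q)"])
    show "norm (\<Psi> (\<phi> q, q) - \<Psi> (\<phi> p, q)) \<le> norm (\<phi> q - \<phi> p) / 2" if "q \<in> U" for q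
      using lip \<phi>(1) Ur that \<open>p \<in> U\<close> by blast
    show "continuous (at p within U) (\<lambda>q. \<Psi> (\<phi> p, q))"
      using cont\<Psi> by (rule continuous_at_imp_continuous_within)
  qed (use \<phi>(2) that in auto)
  then have cont: "continuous_on U \<phi>" by (simp add: continuous_on_eq_continuous_within)
  have "Ck_on k U \<phi>" for k
    by (rule Ck_on_fixpoint[OF findim U(1) smooth \<phi>(2)[symmetric] half[OF \<phi>(1) Ur] cont]) auto
  then have "smooth_on U \<phi>" unfolding smooth_on_def by blast
  moreover have "\<phi> p0 = x0" using \<open>r > 0\<close> base
    unfolding \<phi>_def by (intro the1_equality ex1 U(2)) simp
  ultimately show thesis using that[OF U _ _ \<phi>(2)[symmetric]] by blast
qed

section \<open>Coordinates on alternating maps\<close>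

lemma alt_apply_eqI: "(\<And>x y. alt_apply a x y = alt_apply b x y) \<Longrightarrow> a = b"
  by (simp add: alt_apply_def blinfun_eqI flip: blinfun_of_alt_inject)

lemma alt_apply_map_simps:
  "alt_apply 0 x y = 0"
  "alt_apply (a + b) x y = alt_apply a x y + alt_apply b x y"
  "alt_apply (a - b) x y = alt_apply a x y - alt_apply b x y"
  "alt_apply (r *\<^sub>R a) x y = r *\<^sub>R alt_apply a x y"
  by (simp_all add: alt_apply_def zero_alt_bilin.rep_eq plus_alt_bilin.rep_eq
      minus_alt_bilin.rep_eq scaleR_alt_bilin.rep_eq blinfun.bilinear_simps)

lemma alt_apply_arg_simps:
  "alt_apply a 0 y = 0"
  "alt_apply a x 0 = 0"
  "alt_apply a (x + x') y = alt_apply a x y + alt_apply a x' y"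
  "alt_apply a x (y + y') = alt_apply a x y + alt_apply a x y'"
  "alt_apply a (x - x') y = alt_apply a x y - alt_apply a x' y"
  "alt_apply a x (y - y') = alt_apply a x y - alt_apply a x y'"
  "alt_apply a (- x) y = - alt_apply a x y"
  "alt_apply a x (- y) = - alt_apply a x y"
  "alt_apply a (r *\<^sub>R x) y = r *\<^sub>R alt_apply a x y"
  "alt_apply a x (r *\<^sub>R y) = r *\<^sub>R alt_apply a x y"
  by (simp_all add: alt_apply_def blinfun.bilinear_simps)

lemma alt_apply_same: "alt_apply a x x = 0"
  using blinfun_of_alt[of a] by (simp add: alt_apply_def)

lemma alt_apply_swap: "alt_apply a x y = - alt_apply a y x"
proof -
  have "alt_apply a x y + alt_apply a y x = 0"
    using alt_apply_same[of a "x + y"] unfolding alt_apply_arg_simps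
    by (simp add: alt_apply_same add.commute)
  then show ?thesis by (simp add: eq_neg_iff_add_eq_0)
qed

lemma norm_alt_apply: "norm (alt_apply a x y) \<le> norm a * norm x * norm y"
proof -
  have "norm (alt_apply a x y) \<le> norm (blinfun_of_alt a x) * norm y"
    unfolding alt_apply_def by (rule norm_blinfun)
  also have "\<dots> \<le> norm (blinfun_of_alt a) * norm x * norm y"
    by (intro mult_right_mono norm_blinfun norm_ge_zero)
  finally show ?thesis by (simp add: norm_alt_bilin.rep_eq)
qed

lemma findim_bilinear_blinfun:
  fixes f :: "'a::real_normed_vector \<Rightarrow> 'b::real_normed_vector \<Rightarrow> 'c::real_normed_vector"
  assumes "findim TYPE('a)" and "findim TYPE('b)"
    and f1: "\<And>y. linear (\<lambda>x. f x y)" and f2: "\<And>x. linear (f x)"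
  obtains F :: "'a \<Rightarrow>\<^sub>L 'b \<Rightarrow>\<^sub>L 'c" where "\<And>x y. F x y = f x y"
proof -
  have app: "blinfun_apply (Blinfun (f x)) = f x" for x
    by (rule bounded_linear_Blinfun_apply[OF findim_linear_bounded[OF assms(2) f2]])
  have "linear (\<lambda>x. Blinfun (f x))"
    by (rule linearI; rule blinfun_eqI)
      (simp_all add: app blinfun.add_left blinfun.scaleR_left linear_add[OF f1] linear_scale[OF f1])
  then have "bounded_linear (\<lambda>x. Blinfun (f x))" by (rule findim_linear_bounded[OF assms(1)])
  then have "blinfun_apply (blinfun_apply (Blinfun (\<lambda>x. Blinfun (f x))) x) y = f x y" for x y
    by (simp add: bounded_linear_Blinfun_apply app)
  then show thesis by (rule that)
qed

text \<open>An alternating map is always produced from its values: \<open>J\<close>,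
  \<open>d\<close> and \<open>\<Psi>\<close> below are chosen by \<open>SOME\<close> with prescribed
  \<open>alt_apply\<close>, so the constructor \<open>Alt_bilin\<close> is confined to this
  proof.\<close>

lemma findim_alternating_alt_apply:
  fixes f :: "'a::real_normed_vector \<Rightarrow> 'a \<Rightarrow> 'a"
  assumes "findim TYPE('a)" and "\<And>y. linear (\<lambda>x. f x y)" and "\<And>x. linear (f x)"
    and "\<And>x. f x x = 0"
  shows "\<exists>m. alt_apply m = f"
proof -
  obtain F :: "'a \<Rightarrow>\<^sub>L 'a \<Rightarrow>\<^sub>L 'a" where F: "\<And>x y. F x y = f x y"
    using findim_bilinear_blinfun[OF assms(1,1-3)] by blast
  then have "blinfun_of_alt (Alt_bilin F) = F"
    using assms(4) by (intro Alt_bilin_inverse) simp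
  with F have "alt_apply (Alt_bilin F) = f" by (simp add: alt_apply_def fun_eq_iff)
  then show ?thesis ..
qed

text \<open>\<open>J b b' y\<close> is half the wedge of two coordinate functionals, times y. The
  sum runs over all ordered pairs, so antisymmetrising counts m twice and the factor 1/2 corrects
  this. Smoothness of a map into alternating maps thereby reduces to smoothness of its
  values.\<close>

lemma alt_bilin_coordinates:
  assumes "findim TYPE('a::real_normed_vector)"
  obtains B :: "'a::real_normed_vector set" and J :: "'a \<Rightarrow> 'a \<Rightarrow> 'a \<Rightarrow> 'a alt_bilin"
  where "finite B" and "\<And>b b'. b \<in> B \<Longrightarrow> b' \<in> B \<Longrightarrow> bounded_linear (J b b')"
    and "\<And>m. (\<Sum>b\<in>B. \<Sum>b'\<in>B. J b b' (alt_apply m b b')) = m"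
proof -
  obtain B :: "'a set" and c where B: "finite B" "\<And>b. b \<in> B \<Longrightarrow> bounded_linear (c b)"
    "\<And>x. (\<Sum>b\<in>B. c b x *\<^sub>R b) = x" by (rule findim_coordinates[OF assms]) blast
  define j :: "'a \<Rightarrow> 'a \<Rightarrow> 'a \<Rightarrow> 'a \<Rightarrow> 'a \<Rightarrow> 'a"
    where "j = (\<lambda>b b' y u v. ((c b u * c b' v - c b v * c b' u) / 2) *\<^sub>R y)"
  define J :: "'a \<Rightarrow> 'a \<Rightarrow> 'a \<Rightarrow> 'a alt_bilin"
    where "J = (\<lambda>b b' y. SOME m. alt_apply m = j b b' y)"
  have J: "alt_apply (J b b' y) = j b b' y" if "b \<in> B" "b' \<in> B" for b b' y
  proof -
    note l = bounded_linear.linear[OF B(2)[OF that(1)]] bounded_linear.linear[OF B(2)[OF that(2)]]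
    note s = linear_add[OF l(1)] linear_add[OF l(2)] linear_scale[OF l(1)] linear_scale[OF l(2)]
    have "\<exists>m. alt_apply m = j b b' y"
      by (rule findim_alternating_alt_apply[OF assms]; (rule linearI)?)
        (simp_all add: j_def s algebra_simps add_divide_distrib diff_divide_distrib)
    then show ?thesis unfolding J_def by (rule someI_ex)
  qed
  have "bounded_linear (J b b')" if "b \<in> B" "b' \<in> B" for b b'
    by (rule findim_linear_bounded[OF assms], rule linearI; rule alt_apply_eqI)
      (simp_all add: J[OF that] alt_apply_map_simps j_def algebra_simps)
  moreover have "(\<Sum>b\<in>B. \<Sum>b'\<in>B. J b b' (alt_apply m b b')) = m" for m
  proof (rule alt_apply_eqI)
    fix u v :: 'a
    have lin: "linear (\<lambda>m. alt_apply m u v)" by (rule linearI) (simp_all add: alt_apply_map_simps)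
    have expand: "alt_apply m x y = (\<Sum>b\<in>B. \<Sum>b'\<in>B. (c b x * c b' y) *\<^sub>R alt_apply m b b')" for x y
    proof -
      have l1: "linear (\<lambda>x. alt_apply m x y)" for y
        by (rule linearI) (simp_all add: alt_apply_arg_simps)
      have l2: "linear (alt_apply m x)" for x
        by (rule linearI) (simp_all add: alt_apply_arg_simps)
      have "alt_apply m (\<Sum>b\<in>B. c b x *\<^sub>R b) (\<Sum>b'\<in>B. c b' y *\<^sub>R b')
        = (\<Sum>b\<in>B. \<Sum>b'\<in>B. (c b x * c b' y) *\<^sub>R alt_apply m b b')"
        by (subst linear_sum[OF l1])
          (simp add: linear_sum[OF l2] alt_apply_arg_simps scaleR_sum_right mult.commute)
      then show ?thesis by (simp add: B(3))
    qed
    have "alt_apply (\<Sum>b\<in>B. \<Sum>b'\<in>B. J b b' (alt_apply m b b')) u v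
      = (\<Sum>b\<in>B. \<Sum>b'\<in>B. j b b' (alt_apply m b b') u v)"
      by (simp add: linear_sum[OF lin] J cong: sum.cong)
    also have "\<dots> = (1 / 2) *\<^sub>R (\<Sum>b\<in>B. \<Sum>b'\<in>B. (c b u * c b' v) *\<^sub>R alt_apply m b b')
      - (1 / 2) *\<^sub>R (\<Sum>b\<in>B. \<Sum>b'\<in>B. (c b v * c b' u) *\<^sub>R alt_apply m b b')"
      by (simp add: j_def scaleR_sum_right diff_divide_distrib scaleR_left_diff_distrib sum_subtractf)
    also have "\<dots> = (1 / 2) *\<^sub>R alt_apply m u v - (1 / 2) *\<^sub>R alt_apply m v u"
      by (simp only: expand[symmetric])
    also have "\<dots> = alt_apply m u v"
      using alt_apply_swap[of m v u] by (simp flip: scaleR_left_distrib)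
    finally show "alt_apply (\<Sum>b\<in>B. \<Sum>b'\<in>B. J b b' (alt_apply m b b')) u v = alt_apply m u v" .
  qed
  ultimately show thesis using that[OF B(1)] by blast
qed

lemma findim_alt_bilin:
  assumes "findim TYPE('a::real_normed_vector)"
  shows "findim TYPE('a alt_bilin)"
proof -
  obtain B :: "'a set" and c where B: "finite B" "\<And>b. b \<in> B \<Longrightarrow> bounded_linear (c b)"
    "\<And>x. (\<Sum>b\<in>B. c b x *\<^sub>R b) = x" by (rule findim_coordinates[OF assms]) blast
  obtain B' :: "'a set" and J :: "'a \<Rightarrow> 'a \<Rightarrow> 'a \<Rightarrow> 'a alt_bilin" where J: "finite B'"
    "\<And>b b'. b \<in> B' \<Longrightarrow> b' \<in> B' \<Longrightarrow> bounded_linear (J b b')"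
    "\<And>m. (\<Sum>b\<in>B'. \<Sum>b'\<in>B'. J b b' (alt_apply m b b')) = m"
    by (rule alt_bilin_coordinates[OF assms]) blast
  show ?thesis
  proof (rule findimI[of "B' \<times> B' \<times> B" "\<lambda>(b, b', d). J b b' d"])
    fix m :: "'a alt_bilin"
    have "J b b' (alt_apply m b b') = (\<Sum>d\<in>B. c d (alt_apply m b b') *\<^sub>R J b b' d)"
      if "b \<in> B'" "b' \<in> B'" for b b'
    proof -
      note l = bounded_linear.linear[OF J(2)[OF that]]
      have "J b b' (\<Sum>d\<in>B. c d (alt_apply m b b') *\<^sub>R d)
          = (\<Sum>d\<in>B. c d (alt_apply m b b') *\<^sub>R J b b' d)"
        by (simp add: linear_sum[OF l] linear_scale[OF l])
      then show ?thesis by (simp only: B(3))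
    qed
    then have "(\<Sum>b\<in>B'. \<Sum>b'\<in>B'. J b b' (alt_apply m b b'))
      = (\<Sum>b\<in>B'. \<Sum>b'\<in>B'. \<Sum>d\<in>B. c d (alt_apply m b b') *\<^sub>R J b b' d)"
      by (simp cong: sum.cong)
    then have "m = (\<Sum>i\<in>B' \<times> B' \<times> B. (case i of (b, b', d) \<Rightarrow> c d (alt_apply m b b'))
        *\<^sub>R (case i of (b, b', d) \<Rightarrow> J b b' d))"
      by (simp add: J(3) sum.cartesian_product')
    then show "\<exists>u. m = (\<Sum>i\<in>B' \<times> B' \<times> B. u i *\<^sub>R (case i of (b, b', d) \<Rightarrow> J b b' d))"
      by (rule exI[of _ "\<lambda>i. case i of (b, b', d) \<Rightarrow> c d (alt_apply m b b')"])
  qed (use B(1) J(1) in simp)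
qed

lemma Ck_on_alt_bilinI:
  fixes f :: "'p::real_normed_vector \<Rightarrow> 'a::real_normed_vector alt_bilin"
  assumes "findim TYPE('a)" and "open S"
    and f: "\<And>u v. Ck_on k S (\<lambda>p. alt_apply (f p) u v)"
  shows "Ck_on k S f"
proof -
  obtain B :: "'a set" and J :: "'a \<Rightarrow> 'a \<Rightarrow> 'a \<Rightarrow> 'a alt_bilin" where J: "finite B"
    "\<And>b b'. b \<in> B \<Longrightarrow> b' \<in> B \<Longrightarrow> bounded_linear (J b b')"
    "\<And>m. (\<Sum>b\<in>B. \<Sum>b'\<in>B. J b b' (alt_apply m b b')) = m"
    by (rule alt_bilin_coordinates[OF assms(1)]) blast
  have "Ck_on k S (\<lambda>p. \<Sum>b\<in>B. \<Sum>b'\<in>B. J b b' (alt_apply (f p) b b'))"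
    by (intro Ck_on_sum assms(2) Ck_on_linear_compose[OF assms(2) J(2) f])
  then show ?thesis by (simp only: J(3))
qed

lemma Ck_on_blinfun_apply:
  assumes "open S" and "Ck_on k S f" and "Ck_on k S g"
  shows "Ck_on k S (\<lambda>p. blinfun_apply (f p) (g p))"
  using assms(1) bounded_bilinear_blinfun_apply assms(2,3) by (rule Ck_on_bilinear)

lemma Ck_on_alt_apply:
  assumes "open S" and "Ck_on k S f" and "Ck_on k S g" and "Ck_on k S h"
  shows "Ck_on k S (\<lambda>p. alt_apply (f p) (g p) (h p))"
proof -
  have "bounded_linear blinfun_of_alt"
    by (rule bounded_linear_intro[where K = 1])
      (simp_all add: plus_alt_bilin.rep_eq scaleR_alt_bilin.rep_eq norm_alt_bilin.rep_eq)
  then show ?thesis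
    unfolding alt_apply_def
    by (intro Ck_on_blinfun_apply assms Ck_on_linear_compose[where L = blinfun_of_alt])
qed

section \<open>Deformations and cohomology\<close>

text \<open>Stated with an intertwining relation instead of \<open>gl_act\<close>, because this is
  the form in which the slice equation is delivered; no inverse of A appears.\<close>

lemma is_lie_bracket_transport:
  assumes "inj (blinfun_apply A)"
    and A: "\<And>u v. A (alt_apply \<kappa> u v) = alt_apply \<nu> (A u) (A v)"
    and "is_lie_bracket \<nu>"
  shows "is_lie_bracket \<kappa>"
  unfolding is_lie_bracket_def
proof (intro allI)
  fix x y z
  have "A (alt_apply \<kappa> x (alt_apply \<kappa> y z) + alt_apply \<kappa> y (alt_apply \<kappa> z x)
      + alt_apply \<kappa> z (alt_apply \<kappa> x y)) = A 0"
    using assms(3) by (simp add: is_lie_bracket_def blinfun.add_right A)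
  then show "alt_apply \<kappa> x (alt_apply \<kappa> y z) + alt_apply \<kappa> y (alt_apply \<kappa> z x)
      + alt_apply \<kappa> z (alt_apply \<kappa> x y) = 0"
    by (rule injD[OF assms(1)])
qed

text \<open>The Jacobi identity of \<mu> + w splits by degree in w: degree 0 is the Jacobi identity
  of \<mu>, degree 1 is the coboundary of w in cyclic form, and degree 2 is the Jacobi expression of
  w. This is the Maurer-Cartan equation.\<close>

lemma ce_d2_deformation:
  assumes "is_lie_bracket \<mu>" and "is_lie_bracket (\<mu> + w)"
  shows "ce_d2 \<mu> w x y z = - (alt_apply w x (alt_apply w y z) + alt_apply w y (alt_apply w z x)
    + alt_apply w z (alt_apply w x y))"
proof -
  have \<mu>: "alt_apply \<mu> x (alt_apply \<mu> y z) + alt_apply \<mu> y (alt_apply \<mu> z x)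
      + alt_apply \<mu> z (alt_apply \<mu> x y) = 0"
    using assms(1) by (simp add: is_lie_bracket_def)
  have "alt_apply (\<mu> + w) x (alt_apply (\<mu> + w) y z) + alt_apply (\<mu> + w) y (alt_apply (\<mu> + w) z x)
      + alt_apply (\<mu> + w) z (alt_apply (\<mu> + w) x y) = 0"
    using assms(2) by (simp add: is_lie_bracket_def)
  then have "(alt_apply \<mu> x (alt_apply \<mu> y z) + alt_apply \<mu> y (alt_apply \<mu> z x)
      + alt_apply \<mu> z (alt_apply \<mu> x y))
    + (alt_apply \<mu> x (alt_apply w y z) + alt_apply \<mu> y (alt_apply w z x)
      + alt_apply \<mu> z (alt_apply w x y)
      + alt_apply w x (alt_apply \<mu> y z) + alt_apply w y (alt_apply \<mu> z x)
      + alt_apply w z (alt_apply \<mu> x y))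
    + (alt_apply w x (alt_apply w y z) + alt_apply w y (alt_apply w z x)
      + alt_apply w z (alt_apply w x y)) = 0"
    by (simp add: alt_apply_map_simps alt_apply_arg_simps algebra_simps)
  moreover have "ce_d2 \<mu> w x y z = alt_apply \<mu> x (alt_apply w y z) + alt_apply \<mu> y (alt_apply w z x)
      + alt_apply \<mu> z (alt_apply w x y)
      + alt_apply w x (alt_apply \<mu> y z) + alt_apply w y (alt_apply \<mu> z x)
      + alt_apply w z (alt_apply \<mu> x y)"
    unfolding ce_d2_def alt_apply_swap[of w x z] alt_apply_swap[of \<mu> x z]
      alt_apply_swap[of w "alt_apply \<mu> x y" z] alt_apply_swap[of w "alt_apply \<mu> y z" x]
      alt_apply_swap[of w "- alt_apply \<mu> z x" y]
    by (simp add: alt_apply_arg_simps algebra_simps)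
  ultimately show ?thesis by (simp only: \<mu> add_0_left eq_neg_iff_add_eq_0)
qed

text \<open>The coset of a cocycle is an element of the quotient, so it is the zero coset; a cocycle
  lies in its own coset because 0 is a coboundary.\<close>

lemma H2_zero_imp_Z2_subset_B2:
  assumes "ce_H2 \<mu> = {ce_B2 \<mu>}"
  shows "ce_Z2 \<mu> \<subseteq> ce_B2 \<mu>"
proof
  fix \<phi> assume \<phi>: "\<phi> \<in> ce_Z2 \<mu>"
  let ?R = "{(\<phi>, \<psi>). \<phi> \<in> ce_Z2 \<mu> \<and> \<psi> \<in> ce_Z2 \<mu> \<and> \<phi> - \<psi> \<in> ce_B2 \<mu>}"
  have "?R `` {\<phi>} \<in> ce_H2 \<mu>" unfolding ce_H2_def by (rule quotientI[OF \<phi>])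
  then have "?R `` {\<phi>} = ce_B2 \<mu>" using assms by simp
  moreover have "alt_apply 0 = ce_d1 \<mu> 0"
    by (simp add: ce_d1_def alt_apply_map_simps alt_apply_arg_simps fun_eq_iff)
  then have "0 \<in> ce_B2 \<mu>" unfolding ce_B2_def by blast
  then have "\<phi> \<in> ?R `` {\<phi>}" using \<phi> by simp
  ultimately show "\<phi> \<in> ce_B2 \<mu>" by (simp only:)
qed

text \<open>Here d is \<open>ce_d1\<close> with values in \<open>'a alt_bilin\<close>, and g is a
  linear section of it. Then d o g is a projection onto the coboundaries, and the complementary
  projection provides the slice.\<close>

lemma ce_d1_right_inverse:
  fixes \<mu> :: "'a::real_normed_vector alt_bilin"
  assumes "findim TYPE('a)"
  obtains g :: "'a alt_bilin \<Rightarrow> 'a \<Rightarrow>\<^sub>L 'a" and d :: "('a \<Rightarrow>\<^sub>L 'a) \<Rightarrow> 'a alt_bilin"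
  where "linear g" and "linear d" and "\<And>f. alt_apply (d f) = ce_d1 \<mu> f"
    and "\<And>\<phi>. \<phi> \<in> ce_B2 \<mu> \<Longrightarrow> d (g \<phi>) = \<phi>"
proof -
  define d where "d = (\<lambda>f. SOME m. alt_apply m = ce_d1 \<mu> f)"
  have d: "alt_apply (d f) = ce_d1 \<mu> f" for f
  proof -
    have "\<exists>m. alt_apply m = ce_d1 \<mu> f"
      by (rule findim_alternating_alt_apply[OF assms]; (rule linearI)?)
        (simp_all add: ce_d1_def alt_apply_arg_simps alt_apply_same blinfun.bilinear_simps algebra_simps)
    then show ?thesis unfolding d_def by (rule someI_ex)
  qed
  have lin: "linear d"
    by (rule linearI; rule alt_apply_eqI)
      (simp_all add: d ce_d1_def alt_apply_map_simps alt_apply_arg_simps blinfun.bilinear_simps algebra_simps)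
  obtain g where g: "linear g" "\<And>\<phi>. \<phi> \<in> range d \<Longrightarrow> d (g \<phi>) = \<phi>"
    using linear_exists_right_inverse_on[OF lin subspace_UNIV] by blast
  have "\<phi> \<in> range d" if \<phi>: "\<phi> \<in> ce_B2 \<mu>" for \<phi>
  proof -
    obtain f where "alt_apply \<phi> = ce_d1 \<mu> f" using \<phi> by (auto simp: ce_B2_def)
    then have "\<phi> = d f" by (intro alt_apply_eqI) (simp add: d)
    then show ?thesis by blast
  qed
  with g lin d that show thesis by blast
qed

text \<open>An injective linear map on a finite-dimensional space has a bounded left inverse. The
  map D realises the second coboundary in a normed space of trilinear maps. The conclusion is
  phrased with a pointwise bound C so that this space does not show outside.\<close>

lemma ce_d2_lower_bound:
  fixes \<mu> :: "'a::real_normed_vector alt_bilin"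
  assumes fin: "findim TYPE('a)" and "subspace W"
    and W: "\<And>w. w \<in> W \<Longrightarrow> w \<in> ce_Z2 \<mu> \<Longrightarrow> w = 0"
  obtains K where "K > 0" and
    "\<And>w C. w \<in> W \<Longrightarrow> C \<ge> 0
      \<Longrightarrow> (\<And>x y z. norm (ce_d2 \<mu> w x y z) \<le> C * norm x * norm y * norm z) \<Longrightarrow> norm w \<le> K * C"
proof -
  have "\<exists>T :: 'a \<Rightarrow>\<^sub>L 'a \<Rightarrow>\<^sub>L 'a \<Rightarrow>\<^sub>L 'a. \<forall>x y z. T x y z = ce_d2 \<mu> w x y z" for w
  proof -
    note s = ce_d2_def alt_apply_arg_simps algebra_simps
    have "linear (ce_d2 \<mu> w x y)" for x y by (rule linearI) (simp_all add: s)
    then have app: "blinfun_apply (Blinfun (ce_d2 \<mu> w x y)) = ce_d2 \<mu> w x y" for x y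
      by (intro bounded_linear_Blinfun_apply findim_linear_bounded[OF fin])
    have "linear (\<lambda>x. Blinfun (ce_d2 \<mu> w x y))" "linear (\<lambda>y. Blinfun (ce_d2 \<mu> w x y))" for x y
      by (rule linearI; rule blinfun_eqI; simp add: app blinfun.add_left blinfun.scaleR_left s)+
    then obtain T :: "'a \<Rightarrow>\<^sub>L 'a \<Rightarrow>\<^sub>L 'a \<Rightarrow>\<^sub>L 'a" where "\<And>x y. T x y = Blinfun (ce_d2 \<mu> w x y)"
      using findim_bilinear_blinfun[OF fin fin, of "\<lambda>x y. Blinfun (ce_d2 \<mu> w x y)"] by blast
    with app show ?thesis by (intro exI[of _ T]) simp
  qed
  then obtain D :: "'a alt_bilin \<Rightarrow> 'a \<Rightarrow>\<^sub>L 'a \<Rightarrow>\<^sub>L 'a \<Rightarrow>\<^sub>L 'a"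
    where D: "\<And>w x y z. D w x y z = ce_d2 \<mu> w x y z" by metis
  have lin: "linear D"
    by (rule linearI; intro blinfun_eqI)
      (simp_all add: D blinfun.add_left blinfun.scaleR_left ce_d2_def alt_apply_map_simps
        alt_apply_arg_simps algebra_simps)
  have "inj_on D W"
  proof (rule inj_onI)
    fix v w assume "v \<in> W" "w \<in> W" "D v = D w"
    have "D (v - w) = 0" using \<open>D v = D w\<close> by (simp add: linear_diff[OF lin])
    then have "ce_d2 \<mu> (v - w) x y z = 0" for x y z using D[of "v - w" x y z] by simp
    then have "v - w \<in> ce_Z2 \<mu>" by (simp add: ce_Z2_def)
    then show "v = w"
      using W[of "v - w"] subspace_diff[OF assms(2) \<open>v \<in> W\<close> \<open>w \<in> W\<close>] by simp
  qed
  then obtain L where "linear L" and L: "\<And>w. w \<in> W \<Longrightarrow> L (D w) = w"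
    using linear_exists_left_inverse_on[OF lin assms(2)] by blast
  have "bounded_linear L"
    by (intro findim_linear_bounded[OF _ \<open>linear L\<close>] findim_blinfun fin)
  then obtain K where "K > 0" and K: "\<And>T. norm (L T) \<le> norm T * K"
    using bounded_linear.pos_bounded by blast
  have "norm w \<le> K * C" if w: "w \<in> W" and "C \<ge> 0"
    and b: "\<And>x y z. norm (ce_d2 \<mu> w x y z) \<le> C * norm x * norm y * norm z" for w C
  proof -
    have "norm (D w) \<le> C"
      using \<open>C \<ge> 0\<close> by (intro norm_blinfun_bound mult_nonneg_nonneg norm_ge_zero) (simp_all add: D b)
    then have "norm (D w) * K \<le> C * K" using \<open>K > 0\<close> by simp
    then show ?thesis using K[of "D w"] L[OF w] by (simp add: mult.commute)
  qed
  with \<open>K > 0\<close> that show thesis by blast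
qed

section \<open>A smooth slice for the action\<close>

text \<open>Preimages come from the contraction principle; a difference u - v killed by 1 + X has
  norm at most half of itself.\<close>

lemma id_plus_small_in_GL:
  fixes X :: "'a::real_normed_vector \<Rightarrow>\<^sub>L 'a"
  assumes "findim TYPE('a)" and X: "norm X \<le> 1 / 2"
  shows "id_blinfun + X \<in> GL"
proof -
  have bound: "norm (- X u) \<le> norm u / 2" for u
    using norm_blinfun[of X u] mult_right_mono[OF X norm_ge_zero[of u]] by simp
  have lin: "linear (\<lambda>u. - X u)"
    by (rule linearI) (simp_all add: blinfun.bilinear_simps)
  obtain R where R: "\<And>b. R b = b + - X (R b)"
    by (rule contraction_linear_equation[OF findim_complete[OF assms(1)] lin bound]) blast
  have "R b + X (R b) = b" for b
    using R[of b] unfolding add_uminus_conv_diff eq_diff_eq .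
  then have "(id_blinfun + X) (R b) = b" for b by (simp add: blinfun.add_left)
  then have "surj (id_blinfun + X)" by (rule surjI)
  moreover have "inj (id_blinfun + X)"
  proof (rule injI)
    fix u v assume "(id_blinfun + X) u = (id_blinfun + X) v"
    then have "u - v = - X (u - v)" by (simp add: blinfun.bilinear_simps algebra_simps)
    then have "norm (u - v) = norm (- X (u - v))" by (rule arg_cong)
    also have "\<dots> \<le> norm (u - v) / 2" by (rule bound)
    finally have "norm (u - v) \<le> norm (u - v) / 2" .
    then show "u = v" by simp
  qed
  ultimately show ?thesis by (simp add: GL_def bij_def)
qed

lemma gl_act_eqI:
  assumes "A \<in> GL" and "\<And>u v. A (alt_apply \<mu> u v) = alt_apply \<nu> (A u) (A v)"
  shows "gl_act A \<mu> = alt_apply \<nu>"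
proof -
  have "blinfun_apply A (inv (blinfun_apply A) u) = u" for u
    using assms(1) by (simp add: GL_def bij_is_surj surj_f_inv_f)
  then show ?thesis by (simp add: gl_act_def assms(2) fun_eq_iff)
qed

text \<open>
  Near \<open>\<mu>\<close> every alternating map \<open>\<mu> + n\<close> is moved by some \<open>1 + X\<close> into the affine slice \<open>\<mu> + w\<close>,
  where \<open>w\<close> lies in a complement of the coboundaries. Writing \<open>\<phi> = w - dX\<close>, so that \<open>\<phi>\<close> determines
  both \<open>X = - g \<phi>\<close> and \<open>w\<close>, the equation \<open>(1 + X) \<cdot> (\<mu> + w) = \<mu> + n\<close> becomes a fixed-point
  equation for \<open>\<phi>\<close>.
\<close>

lemma smooth_slice:
  fixes \<mu> :: "'a::real_normed_vector alt_bilin"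
  assumes fin: "findim TYPE('a)"
    and g: "linear g" and d: "linear d" "\<And>f. alt_apply (d f) = ce_d1 \<mu> f"
  obtains U \<phi> where "open U" and "0 \<in> U" and "smooth_on U \<phi>" and "\<phi> 0 = 0"
    and "\<And>n u v. n \<in> U \<Longrightarrow> (id_blinfun - g (\<phi> n)) (alt_apply (\<mu> + (\<phi> n - d (g (\<phi> n)))) u v)
      = alt_apply (\<mu> + n) ((id_blinfun - g (\<phi> n)) u) ((id_blinfun - g (\<phi> n)) v)"
proof -
  note fin2 = findim_alt_bilin[OF fin]
  have gb: "bounded_linear g" using findim_linear_bounded[OF fin2 g] .
  have dgb: "bounded_linear (\<lambda>\<phi>. d (g \<phi>))"
    using findim_linear_bounded[OF fin2 linear_compose[OF g d(1)]] by (simp add: o_def)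
  note gs = linear_0[OF g] linear_scale[OF g] and ds = linear_0[OF d(1)] linear_scale[OF d(1)]
  \<comment> \<open>Multiplying out the intertwining relation for 1 - g \<phi> and inserting the
    formula for d cancels all terms linear in g \<phi> that involve \<mu>. What remains is \<phi> =
    P(\<phi>, n).\<close>
  define P where "P = (\<lambda>(\<phi>, n) u v. alt_apply \<mu> (g \<phi> u) (g \<phi> v)
      + g \<phi> (alt_apply (\<phi> - d (g \<phi>)) u v)
      + alt_apply n ((id_blinfun - g \<phi>) u) ((id_blinfun - g \<phi>) v))"
  define \<Psi> where "\<Psi> = (\<lambda>z. SOME m. alt_apply m = P z)"
  have \<Psi>: "alt_apply (\<Psi> z) = P z" for z
  proof -
    note s = P_def case_prod_unfold alt_apply_arg_simps blinfun.bilinear_simps algebra_simps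
    have "\<exists>m. alt_apply m = P z"
    proof (rule findim_alternating_alt_apply[OF fin])
      show "linear (\<lambda>u. P z u v)" "linear (P z u)" for u v
        by (rule linearI; simp add: s)+
      show "P z u u = 0" for u by (simp add: P_def case_prod_unfold alt_apply_same)
    qed
    then show ?thesis unfolding \<Psi>_def by (rule someI_ex)
  qed
  have smooth: "Ck_on k UNIV \<Psi>" for k
  proof (rule Ck_on_alt_bilinI[OF fin open_UNIV])
    fix u v
    have f: "Ck_on k UNIV (\<lambda>z. fst z)" and s: "Ck_on k UNIV (\<lambda>z. snd z)"
      by (intro Ck_on_linear_compose[where L = fst] Ck_on_linear_compose[where L = snd]
          open_UNIV Ck_on_ident bounded_linear_fst bounded_linear_snd)+
    note gf = Ck_on_linear_compose[OF open_UNIV gb f] and dgf = Ck_on_linear_compose[OF open_UNIV dgb f]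
    show "Ck_on k UNIV (\<lambda>z. alt_apply (\<Psi> z) u v)"
      unfolding \<Psi> P_def case_prod_unfold
      by (intro Ck_on_add Ck_on_diff Ck_on_alt_apply Ck_on_blinfun_apply open_UNIV Ck_on_const
          f s gf dgf)
  qed
  have base: "\<Psi> (0, 0) = 0"
    by (rule alt_apply_eqI)
      (simp add: \<Psi> P_def gs ds alt_apply_map_simps alt_apply_arg_simps blinfun.bilinear_simps)
  have stat: "frechet_derivative \<Psi> (at (0, 0)) (\<phi>, 0) = 0" for \<phi>
  proof -
    \<comment> \<open>At n = 0 the map is homogeneous of degree two in \<phi>, so its derivative at
      the origin can be read off along the line through \<phi>, where t squared has derivative 0 at
      t = 0.\<close>
    have quad: "\<Psi> (t *\<^sub>R \<phi>, 0) = t\<^sup>2 *\<^sub>R \<Psi> (\<phi>, 0)" for t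
      by (rule alt_apply_eqI)
        (simp add: \<Psi> P_def gs ds alt_apply_map_simps alt_apply_arg_simps blinfun.bilinear_simps
          power2_eq_square algebra_simps)
    have D: "(\<Psi> has_derivative frechet_derivative \<Psi> (at (0, 0))) (at (0, 0))"
      by (rule Ck_on_SucD(1)[OF smooth]) simp
    have "((\<lambda>t::real. (t *\<^sub>R \<phi>, 0 :: 'a alt_bilin)) has_derivative (\<lambda>t. (t *\<^sub>R \<phi>, 0))) (at 0)"
      by (intro has_derivative_Pair has_derivative_const has_derivative_scaleR_left
          has_derivative_ident)
    from has_derivative_compose[OF this, of \<Psi>] D
    have "((\<lambda>t. \<Psi> (t *\<^sub>R \<phi>, 0)) has_derivative (\<lambda>t. frechet_derivative \<Psi> (at (0, 0)) (t *\<^sub>R \<phi>, 0))) (at 0)"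
      by simp
    moreover have "((\<lambda>t. \<Psi> (t *\<^sub>R \<phi>, 0)) has_derivative (\<lambda>t. 0)) (at 0)"
      unfolding quad by (auto intro!: derivative_eq_intros)
    ultimately have "(\<lambda>t. frechet_derivative \<Psi> (at (0, 0)) (t *\<^sub>R \<phi>, 0)) = (\<lambda>t. 0)"
      by (rule has_derivative_unique)
    from fun_cong[OF this, of 1] show ?thesis by simp
  qed
  have "smooth_on UNIV \<Psi>" using smooth by (simp add: smooth_on_def)
  then obtain U \<phi> where U: "open U" "0 \<in> U" "smooth_on U \<phi>" "\<phi> 0 = 0"
    and \<phi>: "\<And>n. n \<in> U \<Longrightarrow> \<phi> n = \<Psi> (\<phi> n, n)"
    using smooth_fixpoint[OF fin2 fin2 _ base stat] by blast
  show thesis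
  proof (rule that[OF U])
    fix n u v assume "n \<in> U"
    let ?g = "g (\<phi> n)" and ?w = "\<phi> n - d (g (\<phi> n))"
    have "alt_apply (\<phi> n) u v = P (\<phi> n, n) u v"
      using \<Psi>[of "(\<phi> n, n)"] unfolding \<phi>[OF \<open>n \<in> U\<close>, symmetric] by simp
    moreover have "alt_apply ?w u v = alt_apply (\<phi> n) u v - ce_d1 \<mu> ?g u v"
      by (simp add: alt_apply_map_simps d(2))
    moreover have "alt_apply \<mu> v (?g u) = - alt_apply \<mu> (?g u) v" by (rule alt_apply_swap)
    ultimately have eq: "alt_apply ?w u v = P (\<phi> n, n) u v - alt_apply \<mu> u (?g v) - alt_apply \<mu> (?g u) v
        + ?g (alt_apply \<mu> u v)"
      by (simp add: ce_d1_def)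
    \<comment> \<open>Each expanded bracket term is named by a variable, so that only a
      rearrangement of sums is left.\<close>
    have alg: "x - b - i = c - (e + f) - (k + l - (a + m))"
      if "x = a + b + (c - f - (l - m)) - k - e + i" for x a b c e f i k l m :: 'a
      using that by (simp add: algebra_simps)
    show "(id_blinfun - ?g) (alt_apply (\<mu> + ?w) u v)
        = alt_apply (\<mu> + n) ((id_blinfun - ?g) u) ((id_blinfun - ?g) v)"
      using eq
      by (simp add: alt_apply_map_simps(2) P_def alt_apply_arg_simps blinfun.bilinear_simps)
        (rule alg)
  qed
qed

text \<open>The coboundary of w consists of three terms quadratic in w, so norm w is at most 3 K
  times its own square. A nonzero w would therefore have norm at least 1 / (3 K).\<close>

lemma small_solution_zero:
  fixes \<mu> :: "'a::real_normed_vector alt_bilin"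
  assumes "is_lie_bracket \<mu>" and "is_lie_bracket (\<mu> + w)" and "K > 0"
    and K: "\<And>C. C \<ge> 0 \<Longrightarrow> (\<And>x y z. norm (ce_d2 \<mu> w x y z) \<le> C * norm x * norm y * norm z)
      \<Longrightarrow> norm w \<le> K * C"
    and small: "norm w < 1 / (3 * K)"
  shows "w = 0"
proof (rule ccontr)
  assume "w \<noteq> 0"
  have "norm w \<le> K * (3 * (norm w)\<^sup>2)"
  proof (rule K)
    fix x y z
    have b: "norm (alt_apply w a (alt_apply w b c)) \<le> (norm w)\<^sup>2 * norm a * norm b * norm c" for a b c
    proof -
      have "norm (alt_apply w a (alt_apply w b c)) \<le> norm w * norm a * norm (alt_apply w b c)"
        by (rule norm_alt_apply)
      also have "\<dots> \<le> norm w * norm a * (norm w * norm b * norm c)"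
        by (intro mult_left_mono norm_alt_apply mult_nonneg_nonneg norm_ge_zero)
      finally show ?thesis by (simp add: power2_eq_square mult_ac)
    qed
    have "norm (ce_d2 \<mu> w x y z) \<le> norm (alt_apply w x (alt_apply w y z))
        + norm (alt_apply w y (alt_apply w z x)) + norm (alt_apply w z (alt_apply w x y))"
      unfolding ce_d2_deformation[OF assms(1,2)] norm_minus_cancel
      by (intro norm_triangle_mono order_refl)
    also have "\<dots> \<le> 3 * (norm w)\<^sup>2 * norm x * norm y * norm z"
      using b[of x y z] b[of y z x] b[of z x y] by (simp add: mult_ac)
    finally show "norm (ce_d2 \<mu> w x y z) \<le> 3 * (norm w)\<^sup>2 * norm x * norm y * norm z" .
  qed simp
  then have "norm w * 1 \<le> norm w * (3 * K * norm w)" by (simp add: power2_eq_square mult_ac)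
  then have "1 \<le> 3 * K * norm w" by (rule mult_left_le_imp_le) (use \<open>w \<noteq> 0\<close> in simp)
  then show False using small \<open>K > 0\<close> by (simp add: pos_less_divide_eq mult_ac)
qed

section \<open>From the slice to the smooth map h and to rigidity\<close>

theorem theorem5p3:
  fixes \<mu> :: "'a::real_normed_vector alt_bilin"
  assumes finite_dim: "\<exists>B::'a set. finite B \<and> span B = UNIV"
    and lie: "is_lie_bracket \<mu>"
    and H2: "ce_H2 \<mu> = {ce_B2 \<mu>}"
  shows "(\<exists>(U :: 'a alt_bilin set) (h :: 'a alt_bilin \<Rightarrow> 'a \<Rightarrow>\<^sub>L 'a).
            open U \<and> \<mu> \<in> U \<and> smooth_on U h \<and> h ` U \<subseteq> GL \<and>
            (\<forall>\<mu>'\<in>U. is_lie_bracket \<mu>' \<longrightarrow> gl_act (h \<mu>') \<mu> = alt_apply \<mu>'))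
         \<and> lie_rigid \<mu>"
proof -
  have fin: "findim TYPE('a)" using finite_dim by (simp add: findim_def)
  note fin2 = findim_alt_bilin[OF fin]
  obtain g :: "'a alt_bilin \<Rightarrow> 'a \<Rightarrow>\<^sub>L 'a" and d where g: "linear g"
    and d: "linear d" "\<And>f. alt_apply (d f) = ce_d1 \<mu> f"
    and dg: "\<And>\<phi>. \<phi> \<in> ce_B2 \<mu> \<Longrightarrow> d (g \<phi>) = \<phi>"
    by (rule ce_d1_right_inverse[OF fin, of \<mu>]) blast
  define w where "w = (\<lambda>\<phi>. \<phi> - d (g \<phi>))"
  have lin_w: "linear w"
    by (rule linearI)
      (simp_all add: w_def linear_add[OF g] linear_add[OF d(1)] linear_scale[OF g]
        linear_scale[OF d(1)] algebra_simps)
  have gb: "bounded_linear g" and wb: "bounded_linear w"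
    using findim_linear_bounded[OF fin2] g lin_w by blast+
  \<comment> \<open>The projection d o g annihilates the range of w, and it fixes every coboundary.
    A cocycle is a coboundary since the cohomology vanishes, so both apply to v.\<close>
  have "v = 0" if v: "v \<in> range w" "v \<in> ce_Z2 \<mu>" for v
  proof -
    obtain \<phi> where \<phi>: "v = w \<phi>" using v(1) by blast
    have "d (g \<phi>) \<in> ce_B2 \<mu>" unfolding ce_B2_def using d(2) by blast
    then have "d (g (d (g \<phi>))) = d (g \<phi>)" by (rule dg)
    then have "d (g v) = 0" by (simp add: \<phi> w_def linear_diff[OF g] linear_diff[OF d(1)])
    moreover have "d (g v) = v" using v(2) H2_zero_imp_Z2_subset_B2[OF H2] dg by blast
    ultimately show "v = 0" by simp
  qed
  then obtain K where "K > 0" and K: "\<And>v C. v \<in> range w \<Longrightarrow> C \<ge> 0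
      \<Longrightarrow> (\<And>x y z. norm (ce_d2 \<mu> v x y z) \<le> C * norm x * norm y * norm z) \<Longrightarrow> norm v \<le> K * C"
    by (rule ce_d2_lower_bound[OF fin linear_subspace_image[OF lin_w subspace_UNIV], of \<mu>]) blast+
  obtain U\<^sub>0 \<phi> where U\<^sub>0: "open U\<^sub>0" "0 \<in> U\<^sub>0" "smooth_on U\<^sub>0 \<phi>" "\<phi> 0 = 0"
    and slice: "\<And>n u v. n \<in> U\<^sub>0 \<Longrightarrow> (id_blinfun - g (\<phi> n)) (alt_apply (\<mu> + w (\<phi> n)) u v)
      = alt_apply (\<mu> + n) ((id_blinfun - g (\<phi> n)) u) ((id_blinfun - g (\<phi> n)) v)"
    unfolding w_def by (rule smooth_slice[OF fin g d]) blast
  have cont: "continuous_on U\<^sub>0 \<phi>"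
    using U\<^sub>0(3) Ck_on_imp_continuous_on unfolding smooth_on_def by blast
  \<comment> \<open>The radius 1/2 makes 1 - g \<phi> invertible, and 1 / (3 K) is the threshold of
    \<open>small_solution_zero\<close>. Each preimage is cut with \<open>U\<^sub>0\<close> because
    continuity is available only there.\<close>
  define U\<^sub>1 where "U\<^sub>1 = (U\<^sub>0 \<inter> (\<lambda>n. g (\<phi> n)) -` ball 0 (1 / 2))
    \<inter> (U\<^sub>0 \<inter> (\<lambda>n. w (\<phi> n)) -` ball 0 (1 / (3 * K)))"
  have "open U\<^sub>1" unfolding U\<^sub>1_def
    by (intro open_Int continuous_open_preimage U\<^sub>0(1) open_ball
        bounded_linear.continuous_on[OF gb cont] bounded_linear.continuous_on[OF wb cont])
  have "0 \<in> U\<^sub>1"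
    using U\<^sub>0 \<open>K > 0\<close> by (simp add: U\<^sub>1_def linear_0[OF g] linear_0[OF lin_w])
  define U where "U = (\<lambda>\<nu>. \<nu> - \<mu>) -` U\<^sub>1"
  define h where "h = (\<lambda>\<nu>. id_blinfun - g (\<phi> (\<nu> - \<mu>)))"
  have "continuous_on UNIV (\<lambda>\<nu>. \<nu> - \<mu>)" by (intro continuous_intros)
  then have U: "open U" "\<mu> \<in> U"
    using \<open>0 \<in> U\<^sub>1\<close> open_vimage[OF \<open>open U\<^sub>1\<close>] by (auto simp: U_def)
  have h\<mu>: "h \<mu> = id_blinfun" by (simp add: h_def U\<^sub>0(4) linear_0[OF g])
  have smooth: "Ck_on k U h" for k
  proof -
    have \<phi>k: "Ck_on k U\<^sub>0 \<phi>" using U\<^sub>0(3) by (simp add: smooth_on_def)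
    have sub: "(\<lambda>\<nu>. \<nu> - \<mu>) ` U \<subseteq> U\<^sub>0" by (auto simp: U_def U\<^sub>1_def)
    have "Ck_on k U (\<lambda>\<nu>. \<phi> (\<nu> - \<mu>))"
      by (rule Ck_on_compose[OF fin2 U(1) sub \<phi>k
            Ck_on_diff[OF U(1) Ck_on_ident[OF U(1)] Ck_on_const]])
    then show ?thesis
      unfolding h_def by (rule Ck_on_diff[OF U(1) Ck_on_const Ck_on_linear_compose[OF U(1) gb]])
  qed
  have GL: "h \<nu> \<in> GL" if "\<nu> \<in> U" for \<nu>
    using id_plus_small_in_GL[OF fin, of "- g (\<phi> (\<nu> - \<mu>))"] that
    by (simp add: h_def U_def U\<^sub>1_def)
  have act: "gl_act (h \<nu>) \<mu> = alt_apply \<nu>" if "\<nu> \<in> U" and "is_lie_bracket \<nu>" for \<nu>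
  proof (rule gl_act_eqI[OF GL[OF that(1)]])
    let ?w = "w (\<phi> (\<nu> - \<mu>))"
    have n: "\<nu> - \<mu> \<in> U\<^sub>0" "norm ?w < 1 / (3 * K)" using that(1) by (auto simp: U_def U\<^sub>1_def)
    have eq: "h \<nu> (alt_apply (\<mu> + ?w) u v) = alt_apply \<nu> (h \<nu> u) (h \<nu> v)" for u v
      using slice[OF n(1), of u v] by (simp add: h_def)
    have "inj (h \<nu>)" using GL[OF that(1)] by (simp add: GL_def bij_is_inj)
    \<comment> \<open>The slice equation pulls the Jacobi identity back from \<nu> to \<mu> + w.
      Once w = 0, the same equation relates \<nu> to \<mu> itself.\<close>
    then have "is_lie_bracket (\<mu> + ?w)" using eq that(2) by (rule is_lie_bracket_transport)
    then have "?w = 0"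
      by (rule small_solution_zero[OF lie _ \<open>K > 0\<close> K n(2)]) auto
    with eq show "h \<nu> (alt_apply \<mu> u v) = alt_apply \<nu> (h \<nu> u) (h \<nu> v)" for u v by simp
  qed
  have "lie_rigid \<mu>"
    unfolding lie_rigid_def
  proof (intro allI impI, elim conjE)
    fix V :: "('a \<Rightarrow>\<^sub>L 'a) set" assume V: "open V" "id_blinfun \<in> V"
    \<comment> \<open>Since h is continuous with h(\<mu>) = 1, the preimage of V is the required
      neighbourhood of \<mu>.\<close>
    have "open (U \<inter> h -` V)"
      using continuous_open_preimage[OF Ck_on_imp_continuous_on[OF smooth] U(1) V(1)] .
    moreover have "\<mu> \<in> U \<inter> h -` V" using U(2) h\<mu> V(2) by simp
    moreover have "\<exists>A\<in>V \<inter> GL. alt_apply \<nu> = gl_act A \<mu>"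
      if "\<nu> \<in> U \<inter> h -` V" "is_lie_bracket \<nu>" for \<nu>
      using that GL[of \<nu>] act[of \<nu>] by (intro bexI[of _ "h \<nu>"]) auto
    ultimately show "\<exists>N. open N \<and> \<mu> \<in> N \<and> (\<forall>\<mu>'\<in>N. is_lie_bracket \<mu>' \<longrightarrow>
        (\<exists>A\<in>V \<inter> GL. alt_apply \<mu>' = gl_act A \<mu>))" by blast
  qed
  moreover have "smooth_on U h" using smooth by (simp add: smooth_on_def)
  moreover have "h ` U \<subseteq> GL" using GL by blast
  ultimately show ?thesis using U act by blast
qed

end
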